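(* Let $f:\mathbb{R}^n\to\mathbb{R}$ be twice continuously differentiable with $L$-Lipschitz gradient, let $\varphi_t:\mathbb{R}^{n_t}\to\mathbb{R}$ ($t=1,\dots,p$) be twice continuously differentiable and $\mu_t$-strongly convex with $\mu_t>0$, and let $\mu=\min_t\mu_t$. Let $x^*$ be a strict saddle point of $f$. If $\{x_k\}_{k\ge0}$ is generated by the BMD method with step size $0<\alpha<\frac{\mu}{L}$ from an initial point $x_0$ distributed according to $\nu$, then $$\mathbb{P}_\nu\left[\lim_{k\to\infty}x_k=x^*\right]=0.$$
   Context: $\|\nabla f(x)-\nabla f(y)\|\le L\|x-y\|$ for all $x,y$, with $L>0$. The variable is partitioned as $x=(x(1),\dots,x(p))$, $x(t)\in\mathbb{R}^{n_t}$, $\sum_t n_t=n$; $U_t\in\mathbb{R}^{n\times n_t}$ is the $t$-th block-column of $I_n$ and $\nabla_t f(x)=U_t^T\nabla f(x)$. Strong convexity: $\varphi_t(y)\ge\varphi_t(x)+\langle\nabla\varphi_t(x),y-x\rangle+\frac{\mu_t}{2}\|y-x\|^2$. Bregman divergence: $B_{\varphi_t}(u,v)=\varphi_t(u)-\varphi_t(v)-\langle u-v,\nabla\varphi_t(v)\rangle$. BMD method: given $x_k$, set $x_k^0=x_k$ and for $s=1,\dots,p$ let $x_k^s(s)=\arg\min_{u\in\mathbb{R}^{n_s}}\langle u,\nabla_s f(x_k^{s-1})\rangle+\frac{1}{\alpha}B_{\varphi_s}(u,x_k^{s-1}(s))$ and $x_k^s(t)=x_k^{s-1}(t)$ for $t\neq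 s$; then $x_{k+1}=x_k^p$. A strict saddle is a point $x^*$ with $\nabla f(x^* )=0$ and $\lambda_{\min}(\nabla^2f(x^* ))<0$. $\nu$ is a probability measure on $\mathbb{R}^n$ absolutely continuous with respect to Lebesgue measure. *)

theory Defs
  imports "HOL-Analysis.Analysis" "HOL-Probability.Probability"
begin

definition gradf :: "(real^'n \<Rightarrow> real) \<Rightarrow> real^'n \<Rightarrow> real^'n" where
  "gradf f x = (THE D. GDERIV f x :> D)"

definition hess :: "(real^'n \<Rightarrow> real) \<Rightarrow> real^'n \<Rightarrow> real^'n^'n" where
  "hess f x = matrix (frechet_derivative (gradf f) (at x))"

definition C2 :: "(real^'n \<Rightarrow> real) \<Rightarrow> bool" where
  "C2 f \<longleftrightarrow> (\<forall>x. f differentiable (at x)) \<and> (\<forall>x. gradf f differentiable (at x))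
     \<and> (\<forall>v. continuous_on UNIV (\<lambda>x. frechet_derivative (gradf f) (at x) v))"

definition lambda_min :: "real^'n^'n \<Rightarrow> real" where
  "lambda_min H = Min {l. \<exists>v. v \<noteq> 0 \<and> H *v v = l *\<^sub>R v}"

definition strict_saddle :: "(real^'n \<Rightarrow> real) \<Rightarrow> real^'n \<Rightarrow> bool" where
  "strict_saddle f x \<longleftrightarrow> gradf f x = 0 \<and> lambda_min (hess f x) < 0"

text \<open>Block structure: blk i is the block index of coordinate i. The block space
  R^{n_t} is identified with the coordinate subspace of vectors supported on block t.\<close>
definition block_space :: "('n \<Rightarrow> nat) \<Rightarrow> nat \<Rightarrow> (real^'n) set" where
  "block_space blk t = {u. \<forall>i. blk i \<noteq> t \<longrightarrow> u $ i = 0}"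

definition proj :: "('n \<Rightarrow> nat) \<Rightarrow> nat \<Rightarrow> real^'n \<Rightarrow> real^'n" where
  "proj blk t x = (\<chi> i. if blk i = t then x $ i else 0)"

definition strongly_convex_on :: "(real^'n) set \<Rightarrow> (real^'n \<Rightarrow> real) \<Rightarrow> real \<Rightarrow> bool" where
  "strongly_convex_on S \<phi> m \<longleftrightarrow>
     (\<forall>x\<in>S. \<forall>y\<in>S. \<phi> y \<ge> \<phi> x + gradf \<phi> x \<bullet> (y - x) + m / 2 * (norm (y - x))^2)"

definition bregman :: "(real^'n \<Rightarrow> real) \<Rightarrow> real^'n \<Rightarrow> real^'n \<Rightarrow> real" where
  "bregman \<phi> u v = \<phi> u - \<phi> v - (u - v) \<bullet> gradf \<phi> v"

definition bmd_block_step ::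
  "(real^'n \<Rightarrow> real) \<Rightarrow> (nat \<Rightarrow> real^'n \<Rightarrow> real) \<Rightarrow> real \<Rightarrow> ('n \<Rightarrow> nat) \<Rightarrow> nat \<Rightarrow> real^'n \<Rightarrow> real^'n" where
  "bmd_block_step f \<phi> \<alpha> blk s x =
     (let u = arg_min (\<lambda>u. u \<bullet> proj blk s (gradf f x) + (1 / \<alpha>) * bregman (\<phi> s) u (proj blk s x))
                      (\<lambda>u. u \<in> block_space blk s)
      in (\<chi> i. if blk i = s then u $ i else x $ i))"

definition bmd_map ::
  "(real^'n \<Rightarrow> real) \<Rightarrow> (nat \<Rightarrow> real^'n \<Rightarrow> real) \<Rightarrow> real \<Rightarrow> ('n \<Rightarrow> nat) \<Rightarrow> nat \<Rightarrow> real^'n \<Rightarrow> real^'n" where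
  "bmd_map f \<phi> \<alpha> blk p x = fold (bmd_block_step f \<phi> \<alpha> blk) [1..<Suc p] x"

end

theory Submission
  imports Defs
begin

text \<open>
  Let \<open>H\<close> be the Hessian at the saddle and \<open>M\<close> the derivative of the iteration map \<open>g\<close> there. Each
  linearised block step decreases the form \<open>v \<bullet> H v\<close>, strictly unless it fixes \<open>v\<close>, so \<open>M\<close> does the
  same and is the identity on the kernel of \<open>H\<close>. Adding a small form supported on that kernel gives a
  quadratic form \<open>\<beta>\<close>, still negative somewhere, with \<open>\<beta> (M v) \<le> \<rho> \<beta> v - c |v|\<^sup>2\<close> for some \<open>\<rho> > 1\<close>. As
  \<open>g\<close> is strictly differentiable at the saddle, differences of nearby orbits obey \<open>\<beta> \<le> \<rho> \<beta>\<close>, so two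
  points whose orbits stay near the saddle never differ by a multiple of a direction \<open>w\<close> with
  \<open>\<beta> w < 0\<close>. The compact set of such points has infinitely many disjoint translates inside a bounded
  set, hence is null; no stable manifold theorem or spectral theory of \<open>M\<close> is needed. Finally \<open>g\<close>
  pulls null sets back to null sets, because a block step solves \<open>A (step x) = B x\<close> with \<open>A\<close>
  differentiable and \<open>B\<close> strongly monotone.
\<close>

section \<open>Strict differentiability\<close>

text \<open>Strict (strong) Frechet differentiability: both arguments vary near \<open>a\<close>.
  This is the notion that controls differences of two orbits, and it can be imposed at the single
  point of interest.\<close>

definition has_strict_derivative ::
  "('a::real_normed_vector \<Rightarrow> 'b::real_normed_vector) \<Rightarrow> ('a \<Rightarrow> 'b) \<Rightarrow> 'a \<Rightarrow> bool" where
  "has_strict_derivative F F' a \<longleftrightarrow> bounded_linear F' \<and>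
     (\<forall>e>0. \<exists>d>0. \<forall>x\<in>ball a d. \<forall>y\<in>ball a d. norm (F x - F y - F' (x - y)) \<le> e * norm (x - y))"

lemma has_strict_derivativeD:
  assumes "has_strict_derivative F F' a" "e > 0"
  obtains d where "d > 0"
    "\<And>x y. x \<in> ball a d \<Longrightarrow> y \<in> ball a d \<Longrightarrow> norm (F x - F y - F' (x - y)) \<le> e * norm (x - y)"
  using assms unfolding has_strict_derivative_def by blast

lemma linear_bounded_by_Basis:
  fixes F :: "'a::euclidean_space \<Rightarrow> 'b::real_normed_vector"
  assumes "linear F" "\<And>b. b \<in> Basis \<Longrightarrow> norm (F b) \<le> e"
  shows "norm (F x) \<le> real DIM('a) * e * norm x"
proof -
  have "F x = (\<Sum>b\<in>Basis. (x \<bullet> b) *\<^sub>R F b)"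
    by (subst euclidean_representation[of x, symmetric])
      (simp only: linear_sum[OF assms(1)] linear_cmul[OF assms(1)])
  also have "norm \<dots> \<le> (\<Sum>b\<in>(Basis::'a set). e * norm x)"
  proof (rule sum_norm_le)
    fix b :: 'a assume b: "b \<in> Basis"
    have "norm ((x \<bullet> b) *\<^sub>R F b) \<le> norm x * e"
      using Basis_le_norm[OF b, of x] assms(2)[OF b] by (simp add: mult_mono)
    then show "norm ((x \<bullet> b) *\<^sub>R F b) \<le> e * norm x" by (simp add: mult.commute)
  qed
  finally show ?thesis by simp
qed

text \<open>The mean value inequality is applied to \<open>F\<close> minus its linearisation at
  \<open>a\<close> on a small ball. Continuity of the derivative is given direction by direction;
  bounding the difference of derivatives on the finitely many basis vectors upgrades it to the
  operator norm.\<close>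

lemma has_strict_derivative_C1:
  fixes F :: "'a::euclidean_space \<Rightarrow> 'b::real_normed_vector"
  assumes der: "\<And>x. (F has_derivative F' x) (at x)"
    and cont: "\<And>v. continuous_on UNIV (\<lambda>x. F' x v)"
  shows "has_strict_derivative F (F' a) a"
  unfolding has_strict_derivative_def
proof (intro conjI allI impI)
  have bl: "bounded_linear (F' x)" for x
    using der has_derivative_bounded_linear by blast
  show "bounded_linear (F' a)" by (rule bl)
  fix e :: real assume "e > 0"
  define e' where "e' = e / real DIM('a)"
  have "e' > 0" using \<open>e > 0\<close> by (simp add: e'_def)
  have "\<forall>\<^sub>F x in nhds a. \<forall>b\<in>Basis. dist (F' x b) (F' a b) < e'"
  proof (rule eventually_ball_finite)
    show "\<forall>b\<in>Basis. \<forall>\<^sub>F x in nhds a. dist (F' x b) (F' a b) < e'"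
      using cont \<open>e' > 0\<close> by (metis UNIV_I continuous_on_def open_UNIV tendstoD
          at_within_open continuous_on_eq_continuous_at isCont_def tendsto_at_iff_tendsto_nhds)
  qed simp
  then obtain d where "d > 0"
    and d: "\<And>x b. dist x a < d \<Longrightarrow> b \<in> Basis \<Longrightarrow> dist (F' x b) (F' a b) < e'"
    unfolding eventually_nhds_metric by blast
  have on: "onorm (\<lambda>v. F' x v - F' a v) \<le> e" if "x \<in> ball a d" for x
  proof (rule onorm_le)
    fix v
    have "linear (\<lambda>v. F' x v - F' a v)"
      by (intro linear_compose_sub bounded_linear.linear bl)
    then have "norm (F' x v - F' a v) \<le> real DIM('a) * e' * norm v"
      by (rule linear_bounded_by_Basis)
        (use d[of x] that in \<open>auto simp: dist_norm norm_minus_commute less_imp_le\<close>)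
    then show "norm (F' x v - F' a v) \<le> e * norm v" by (simp add: e'_def)
  qed
  have "norm (F x - F y - F' a (x - y)) \<le> e * norm (x - y)"
    if "x \<in> ball a d" "y \<in> ball a d" for x y
  proof -
    have "norm ((F x - F' a x) - (F y - F' a y)) \<le> e * norm (x - y)"
      by (rule differentiable_bound[OF convex_ball _ on that])
        (auto intro!: has_derivative_diff has_derivative_at_withinI[OF der]
          bounded_linear_imp_has_derivative bl)
    then show ?thesis
      using bl[of a] by (simp add: linear_diff bounded_linear.linear algebra_simps)
  qed
  then show "\<exists>d>0. \<forall>x\<in>ball a d. \<forall>y\<in>ball a d. norm (F x - F y - F' a (x - y)) \<le> e * norm (x - y)"
    using \<open>d > 0\<close> by blast
qed

lemma has_strict_derivative_lipschitz:
  assumes "has_strict_derivative F F' a"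
  obtains d C where "d > 0" "C > 0"
    "\<And>x y. x \<in> ball a d \<Longrightarrow> y \<in> ball a d \<Longrightarrow> norm (F x - F y) \<le> C * norm (x - y)"
proof -
  obtain d where d: "d > 0"
    "\<And>x y. x \<in> ball a d \<Longrightarrow> y \<in> ball a d \<Longrightarrow> norm (F x - F y - F' (x - y)) \<le> 1 * norm (x - y)"
    using has_strict_derivativeD[OF assms zero_less_one] by metis
  obtain K where K: "K > 0" "\<And>x. norm (F' x) \<le> norm x * K"
    using assms bounded_linear.pos_bounded unfolding has_strict_derivative_def by blast
  show thesis
  proof (rule that[of d "1 + K"])
    fix x y assume "x \<in> ball a d" "y \<in> ball a d"
    then have "norm (F x - F y - F' (x - y)) \<le> norm (x - y)" using d(2) by force
    moreover have "norm (F x - F y) \<le> norm (F x - F y - F' (x - y)) + norm (F' (x - y))"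
      using norm_triangle_ineq[of "F x - F y - F' (x - y)" "F' (x - y)"] by simp
    ultimately show "norm (F x - F y) \<le> (1 + K) * norm (x - y)"
      using K(2)[of "x - y"] by (simp add: algebra_simps)
  qed (use d K in auto)
qed

lemma has_strict_derivative_compose:
  assumes F: "has_strict_derivative F F' a" and G: "has_strict_derivative G G' (F a)"
  shows "has_strict_derivative (G \<circ> F) (G' \<circ> F') a"
  unfolding has_strict_derivative_def
proof (intro conjI allI impI)
  have bF: "bounded_linear F'" and bG: "bounded_linear G'"
    using F G by (auto simp: has_strict_derivative_def)
  then show "bounded_linear (G' \<circ> F')" by (simp add: bounded_linear_compose comp_def)
  obtain d1 C where d1: "d1 > 0" "C > 0"
    "\<And>x y. x \<in> ball a d1 \<Longrightarrow> y \<in> ball a d1 \<Longrightarrow> norm (F x - F y) \<le> C * norm (x - y)"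
    using has_strict_derivative_lipschitz[OF F] by metis
  obtain K where K: "K > 0" "\<And>x. norm (G' x) \<le> norm x * K"
    using bG bounded_linear.pos_bounded by blast
  fix e :: real assume "e > 0"
  \<comment> \<open>The error of the composite is the error of \<open>G\<close> at the images plus
    \<open>G'\<close> applied to the error of \<open>F\<close>. The tolerances
    \<open>e / (2 * C)\<close> here and \<open>e / (2 * K)\<close> below make each summand at most
    half of the target.\<close>
  obtain d2 where d2: "d2 > 0" "\<And>x y. x \<in> ball (F a) d2 \<Longrightarrow> y \<in> ball (F a) d2 \<Longrightarrow>
      norm (G x - G y - G' (x - y)) \<le> e / (2 * C) * norm (x - y)"
    using has_strict_derivativeD[OF G, of "e / (2 * C)"] \<open>e > 0\<close> d1 by (metis divide_pos_pos mult_pos_pos zero_less_numeral)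
  obtain d3 where d3: "d3 > 0" "\<And>x y. x \<in> ball a d3 \<Longrightarrow> y \<in> ball a d3 \<Longrightarrow>
      norm (F x - F y - F' (x - y)) \<le> e / (2 * K) * norm (x - y)"
    using has_strict_derivativeD[OF F, of "e / (2 * K)"] \<open>e > 0\<close> K by (metis divide_pos_pos mult_pos_pos zero_less_numeral)
  define d where "d = min (min d1 d3) (d2 / C)"
  have "d > 0" using d1 d2 d3 by (simp add: d_def)
  moreover have "norm ((G \<circ> F) x - (G \<circ> F) y - (G' \<circ> F') (x - y)) \<le> e * norm (x - y)"
    if x: "x \<in> ball a d" and y: "y \<in> ball a d" for x y
  proof -
    have inb: "F z \<in> ball (F a) d2" if "z \<in> ball a d" for z
    proof -
      have "norm (F a - F z) \<le> C * norm (a - z)"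
        using d1(1) that by (intro d1(3)) (auto simp: d_def)
      also have "\<dots> < d2"
        using that d1(2) by (auto simp: d_def dist_norm field_simps)
      finally show ?thesis by (simp add: dist_norm)
    qed
    have 1: "norm (G (F x) - G (F y) - G' (F x - F y)) \<le> e / (2 * C) * norm (F x - F y)"
      using d2(2) inb x y by blast
    have 2: "norm (F x - F y) \<le> C * norm (x - y)"
      using x y by (intro d1(3)) (auto simp: d_def)
    have "e / (2 * C) * norm (F x - F y) \<le> e / (2 * C) * (C * norm (x - y))"
      using \<open>e > 0\<close> d1(2) by (intro mult_left_mono 2) auto
    then have 3: "e / (2 * C) * norm (F x - F y) \<le> e / 2 * norm (x - y)"
      using d1(2) by simp
    have "norm (F x - F y - F' (x - y)) \<le> e / (2 * K) * norm (x - y)"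
      using x y by (intro d3(2)) (auto simp: d_def)
    then have "norm (F x - F y - F' (x - y)) * K \<le> e / (2 * K) * norm (x - y) * K"
      using K(1) by (intro mult_right_mono) auto
    then have 4: "norm (G' (F x - F y - F' (x - y))) \<le> e / 2 * norm (x - y)"
      using K by (intro order_trans[OF K(2)]) simp
    have "(G \<circ> F) x - (G \<circ> F) y - (G' \<circ> F') (x - y) =
        (G (F x) - G (F y) - G' (F x - F y)) + G' (F x - F y - F' (x - y))"
      using bG by (simp add: linear_diff bounded_linear.linear)
    moreover have "norm ((G (F x) - G (F y) - G' (F x - F y)) + G' (F x - F y - F' (x - y)))
        \<le> e * norm (x - y)"
      using norm_triangle_mono[OF order_trans[OF 1 3] 4] by simp
    ultimately show ?thesis by metis
  qed
  ultimately show "\<exists>d>0. \<forall>x\<in>ball a d. \<forall>y\<in>ball a d.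
      norm ((G \<circ> F) x - (G \<circ> F) y - (G' \<circ> F') (x - y)) \<le> e * norm (x - y)"
    by blast
qed

text \<open>Schwarz's theorem at one point: the second difference of \<open>f\<close> over a small
  parallelogram is symmetric in \<open>u\<close> and \<open>v\<close>, and strict differentiability
  of the gradient approximates it both by \<open>u \<bullet> H v\<close> and by
  \<open>v \<bullet> H u\<close>, up to the factor \<open>t\<^sup>2\<close>.\<close>

lemma strict_derivative_gradient_symmetric:
  fixes f :: "'a::real_inner \<Rightarrow> real"
  assumes grad: "\<And>x. (f has_derivative (\<lambda>h. h \<bullet> F x)) (at x)"
    and F: "has_strict_derivative F H a"
  shows "H u \<bullet> v = u \<bullet> H v"
proof -
  have lin: "linear H"
    using F by (simp add: has_strict_derivative_def bounded_linear.linear)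
  have close: "\<bar>H u \<bullet> v - u \<bullet> H v\<bar> \<le> 2 * e * (norm u * norm v)" if "e > 0" for e
  proof -
    obtain d where d: "d > 0" "\<And>x y. x \<in> ball a d \<Longrightarrow> y \<in> ball a d \<Longrightarrow>
        norm (F x - F y - H (x - y)) \<le> e * norm (x - y)"
      using has_strict_derivativeD[OF F \<open>e > 0\<close>] by metis
    \<comment> \<open>This scale keeps the whole parallelogram in the ball; the summand 1 keeps the
      denominator positive when both vectors vanish.\<close>
    define t where "t = d / (2 * (norm u + norm v + 1))"
    have pos: "norm u + norm v + 1 > 0" by (smt (verit) norm_ge_zero)
    have t: "t > 0" using d pos by (simp add: t_def)
    have tuv: "t * norm u + t * norm v < d"
    proof -
      have "t * (2 * (norm u + norm v + 1)) = d" using pos unfolding t_def by auto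
      then show ?thesis using t d by (simp add: algebra_simps)
    qed
    define S where "S = f (a + t *\<^sub>R u + t *\<^sub>R v) - f (a + t *\<^sub>R u) - f (a + t *\<^sub>R v) + f a"
    have half: "\<bar>f (a + t *\<^sub>R u + t *\<^sub>R v) - f (a + t *\<^sub>R u) - f (a + t *\<^sub>R v) + f a - t\<^sup>2 * (u \<bullet> H v)\<bar>
        \<le> e * t\<^sup>2 * (norm u * norm v)" if tuv: "t * norm u + t * norm v < d" for u v
    proof -
      \<comment> \<open>The second difference is the increment of \<open>g\<close> over the unit
        interval. The mean value theorem turns it into a difference of gradients at two points that
        differ by exactly \<open>t *\<^sub>R v\<close>.\<close>
      define g where "g = (\<lambda>s. f (a + s *\<^sub>R t *\<^sub>R u + t *\<^sub>R v) - f (a + s *\<^sub>R t *\<^sub>R u))"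
      define g' where "g' = (\<lambda>s h. (h *\<^sub>R t *\<^sub>R u) \<bullet> F (a + s *\<^sub>R t *\<^sub>R u + t *\<^sub>R v)
          - (h *\<^sub>R t *\<^sub>R u) \<bullet> F (a + s *\<^sub>R t *\<^sub>R u))"
      have "(g has_derivative g' s) (at s within {0..1})" for s
        unfolding g_def g'_def
        by (intro has_derivative_diff has_derivative_compose[OF _ grad])
          (auto intro!: derivative_eq_intros)
      then obtain s where s: "s \<in> {0..1}" "g 1 - g 0 = g' s (1 - 0)"
        using mvt_very_simple[of 0 1 g g'] by auto
      let ?x = "a + s *\<^sub>R t *\<^sub>R u + t *\<^sub>R v" and ?y = "a + s *\<^sub>R t *\<^sub>R u"
      have st: "s * (t * norm u) \<le> t * norm u" "0 \<le> s" "0 \<le> t * norm v"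
        using s t by (auto intro!: mult_left_le_one_le)
      have "norm (s *\<^sub>R t *\<^sub>R u + t *\<^sub>R v) < d"
      proof -
        have "norm (s *\<^sub>R t *\<^sub>R u) = s * (t * norm u)" "norm (t *\<^sub>R v) = t * norm v"
          using st t by simp_all
        then show ?thesis
          using norm_triangle_ineq[of "s *\<^sub>R t *\<^sub>R u" "t *\<^sub>R v"] st tuv by linarith
      qed
      moreover have "norm (s *\<^sub>R t *\<^sub>R u) < d"
      proof -
        have "norm (s *\<^sub>R t *\<^sub>R u) = s * (t * norm u)" using st t by simp
        then show ?thesis using st tuv by linarith
      qed
      moreover have "a + z \<in> ball a d" if "norm z < d" for z
        using that by (simp add: dist_norm)
      ultimately have "?x \<in> ball a d" "?y \<in> ball a d"
        by (metis add.assoc)+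
      then have "norm (F ?x - F ?y - H (?x - ?y)) \<le> e * norm (?x - ?y)" by (rule d(2))
      then have n: "norm (F ?x - F ?y - t *\<^sub>R H v) \<le> e * (t * norm v)"
        using t by (simp add: linear_cmul[OF lin])
      have "g 1 - g 0 - t\<^sup>2 * (u \<bullet> H v) = (t *\<^sub>R u) \<bullet> (F ?x - F ?y - t *\<^sub>R H v)"
        using s(2) by (simp add: g'_def inner_diff_right power2_eq_square algebra_simps)
      also have "\<bar>\<dots>\<bar> \<le> norm (t *\<^sub>R u) * norm (F ?x - F ?y - t *\<^sub>R H v)"
        by (rule Cauchy_Schwarz_ineq2)
      also have "\<dots> \<le> (t * norm u) * (e * (t * norm v))"
        using n t by (intro mult_mono) auto
      finally show ?thesis by (simp add: g_def algebra_simps power2_eq_square)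
    qed
    have 1: "\<bar>S - t\<^sup>2 * (u \<bullet> H v)\<bar> \<le> e * t\<^sup>2 * (norm u * norm v)"
      using half[of u v] tuv by (simp add: S_def)
    have "a + t *\<^sub>R v + t *\<^sub>R u = a + t *\<^sub>R u + t *\<^sub>R v" by simp
    then have 2: "\<bar>S - t\<^sup>2 * (v \<bullet> H u)\<bar> \<le> e * t\<^sup>2 * (norm u * norm v)"
      using half[of v u] tuv by (simp add: S_def algebra_simps)
    have "t\<^sup>2 * \<bar>H u \<bullet> v - u \<bullet> H v\<bar> = \<bar>t\<^sup>2 * (v \<bullet> H u) - t\<^sup>2 * (u \<bullet> H v)\<bar>"
      by (simp add: abs_mult inner_commute flip: right_diff_distrib)
    also have "\<dots> \<le> t\<^sup>2 * (2 * e * (norm u * norm v))"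
      using 1 2 by (simp add: algebra_simps)
    finally show ?thesis using t by simp
  qed
  have "\<bar>H u \<bullet> v - u \<bullet> H v\<bar> \<le> 0"
  proof (rule field_le_epsilon)
    fix e :: real assume "e > 0"
    define c where "c = 2 * (norm u * norm v) + 1"
    have "c > 0" by (simp add: c_def add_nonneg_pos)
    have "\<bar>H u \<bullet> v - u \<bullet> H v\<bar> \<le> (e / c) * (2 * (norm u * norm v))"
      using close[of "e / c"] \<open>e > 0\<close> \<open>c > 0\<close> by (simp add: mult_ac)
    also have "\<dots> \<le> (e / c) * c"
      using \<open>e > 0\<close> \<open>c > 0\<close> by (intro mult_left_mono) (auto simp: c_def)
    finally show "\<bar>H u \<bullet> v - u \<bullet> H v\<bar> \<le> 0 + e" using \<open>c > 0\<close> by simp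
  qed
  then show ?thesis by simp
qed

section \<open>Null sets and expanding dynamics\<close>

text \<open>The translates by \<open>w\<close> divided by n+1 cannot meet, since a common point
  would give two points of \<open>S\<close> on one line in direction \<open>w\<close>. They stay in
  a bounded set and have equal measure, so a constant series converges and the constant is
  0.\<close>

lemma negligible_disjoint_translates:
  fixes S :: "'a::euclidean_space set"
  assumes S: "compact S" and dis: "\<And>x t. x \<in> S \<Longrightarrow> x + t *\<^sub>R w \<in> S \<Longrightarrow> t = 0"
  shows "negligible S"
proof -
  define T where "T = (\<lambda>n. (+) (inverse (real (Suc n)) *\<^sub>R w) ` S)"
  have meas: "T n \<in> lmeasurable" for n
    unfolding T_def by (intro measurable_translation lmeasurable_compact S)
  have disj: "pairwise (\<lambda>m n. negligible (T m \<inter> T n)) UNIV"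
  proof (rule pairwiseI)
    fix m n :: nat assume "m \<noteq> n"
    have "T m \<inter> T n = {}"
    proof (rule ccontr)
      assume "T m \<inter> T n \<noteq> {}"
      then obtain x y where xy: "x \<in> S" "y \<in> S"
        "inverse (real (Suc m)) *\<^sub>R w + x = inverse (real (Suc n)) *\<^sub>R w + y"
        by (auto simp: T_def)
      then have "y = x + (inverse (real (Suc m)) - inverse (real (Suc n))) *\<^sub>R w"
        by (simp add: algebra_simps)
      then have "inverse (real (Suc m)) - inverse (real (Suc n)) = 0"
        using dis xy by blast
      then show False using \<open>m \<noteq> n\<close> by simp
    qed
    then show "negligible (T m \<inter> T n)" by simp
  qed
  have bdd: "bounded (\<Union>n. T n)"
  proof -
    obtain B where B: "\<And>x. x \<in> S \<Longrightarrow> norm x \<le> B"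
      using compact_imp_bounded[OF S] unfolding bounded_iff by blast
    have "norm (inverse (real (Suc n)) *\<^sub>R w + x) \<le> norm w + B" if "x \<in> S" for n x
    proof -
      have "norm (inverse (real (Suc n)) *\<^sub>R w) \<le> norm w"
        by (simp add: field_simps)
      then show ?thesis using B[OF that] norm_triangle_mono by blast
    qed
    then show ?thesis unfolding bounded_iff T_def by blast
  qed
  have "(\<lambda>n. measure lebesgue (T n)) sums measure lebesgue (\<Union>n. T n)"
    by (rule measure_countable_negligible_Union_bounded[OF meas disj bdd])
  then have "summable (\<lambda>n::nat. measure lebesgue S)"
    unfolding T_def measure_translation by (rule sums_summable)
  then have "measure lebesgue S = 0" by (simp add: summable_const_iff)
  then show ?thesis
    using negligible_iff_measure lmeasurable_compact[OF S] by blast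
qed

lemma strongly_monotone_norm:
  fixes F :: "'a::real_inner \<Rightarrow> 'a"
  assumes "m * (norm (x - y))\<^sup>2 \<le> (F x - F y) \<bullet> (x - y)"
  shows "m * norm (x - y) \<le> norm (F x - F y)"
proof (cases "x = y")
  case False
  have "m * norm (x - y) * norm (x - y) \<le> norm (F x - F y) * norm (x - y)"
    using assms norm_cauchy_schwarz[of "F x - F y" "x - y"]
    by (simp add: power2_eq_square mult.assoc)
  then show ?thesis using False by simp
qed simp

text \<open>The inverse on the range of \<open>F\<close> is Lipschitz with constant
  \<open>1 / m\<close>, and Lipschitz images of null sets are null.\<close>

lemma negligible_vimage_expanding:
  fixes F :: "'a::euclidean_space \<Rightarrow> 'a"
  assumes "m > 0" and exp: "\<And>x y. m * norm (x - y) \<le> norm (F x - F y)" and N: "negligible N"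
  shows "negligible (F -` N)"
proof -
  have inj: "inj F"
    using exp \<open>m > 0\<close> by (intro injI) (metis cancel_comm_monoid_add_class.diff_cancel eq_iff_diff_eq_0
      mult_le_0_iff norm_eq_zero norm_le_zero_iff norm_zero not_le)
  have "negligible (inv F ` (N \<inter> range F))"
  proof (rule negligible_locally_Lipschitz_image)
    fix y assume y: "y \<in> N \<inter> range F"
    have "norm (inv F z - inv F y) \<le> 1 / m * norm (z - y)" if "z \<in> N \<inter> range F" for z
      using exp[of "inv F z" "inv F y"] y that \<open>m > 0\<close> by (simp add: f_inv_into_f field_simps)
    then show "\<exists>T B. open T \<and> y \<in> T \<and> (\<forall>z\<in>N \<inter> range F \<inter> T. norm (inv F z - inv F y) \<le> B * norm (z - y))"
      by (intro exI[of _ UNIV] exI[of _ "1 / m"]) auto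
  qed (use N in \<open>auto intro: negligible_subset\<close>)
  moreover have "F -` N \<subseteq> inv F ` (N \<inter> range F)"
    using inj by (force simp: image_iff)
  ultimately show ?thesis by (rule negligible_subset)
qed

text \<open>Differences of two trapped orbits with \<open>\<beta> < 0\<close> would grow geometrically, so a line in a
  direction \<open>w\<close> with \<open>\<beta> w w < 0\<close> meets the trapped set at most once.\<close>

lemma negligible_trapped_points:
  fixes g :: "'a::euclidean_space \<Rightarrow> 'a" and \<beta> :: "'a \<Rightarrow> 'a \<Rightarrow> real"
  assumes cont: "continuous_on UNIV g" and g: "has_strict_derivative g M a"
    and \<beta>: "bounded_bilinear \<beta>" and "\<rho> > 1" "c > 0"
    and exp: "\<And>v. \<beta> (M v) (M v) \<le> \<rho> * \<beta> v v - c * (norm v)\<^sup>2"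
    and w: "\<beta> w w < 0"
  obtains r where "r > 0" "negligible {x. \<forall>k. (g ^^ k) x \<in> cball a r}"
proof -
  interpret \<beta>: bounded_bilinear \<beta> by fact
  obtain K where K: "K > 0" "\<And>x y. norm (\<beta> x y) \<le> norm x * norm y * K"
    using \<beta>.pos_bounded by blast
  obtain N where N: "N > 0" "\<And>x. norm (M x) \<le> norm x * N"
    using g bounded_linear.pos_bounded unfolding has_strict_derivative_def by blast
  \<comment> \<open>With \<open>g x - g y = M v + h\<close> and
    \<open>norm h \<le> e * norm v\<close>, the two cross terms and \<open>\<beta> h h\<close> cost
    at most \<open>e * K * (2 * N + 1)\<close> times \<open>(norm v)\<^sup>2\<close>, which this
    \<open>e\<close> keeps below the gap \<open>c\<close>. The bound by 1 serves to estimate the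
    product of two small factors in \<open>\<beta> h h\<close> linearly in \<open>e\<close>.\<close>
  define e where "e = min 1 (c / (K * (2 * N + 1)))"
  have e: "e > 0" "e \<le> 1" using K N \<open>c > 0\<close> by (auto simp: e_def)
  have eK: "e * (K * (2 * N + 1)) \<le> c"
  proof -
    have "e \<le> c / (K * (2 * N + 1))" by (simp add: e_def)
    moreover have "K * (2 * N + 1) > 0" using K N by simp
    ultimately show ?thesis by (simp add: pos_le_divide_eq)
  qed
  obtain d where d: "d > 0" "\<And>x y. x \<in> ball a d \<Longrightarrow> y \<in> ball a d \<Longrightarrow>
      norm (g x - g y - M (x - y)) \<le> e * norm (x - y)"
    using has_strict_derivativeD[OF g e(1)] by metis
  \<comment> \<open>Half the radius: the closed ball lies in the open ball of radius
    \<open>d\<close>, and two of its points differ by at most \<open>d\<close>.\<close>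
  define r where "r = d / 2"
  define S where "S = {x. \<forall>k. (g ^^ k) x \<in> cball a r}"
  have step: "\<beta> (g x - g y) (g x - g y) \<le> \<rho> * \<beta> (x - y) (x - y)"
    if "x \<in> cball a r" "y \<in> cball a r" for x y
  proof -
    define v where "v = x - y"
    define h where "h = g x - g y - M v"
    have h: "norm h \<le> e * norm v"
      unfolding h_def v_def using that d(1) by (intro d(2)) (auto simp: r_def)
    have "\<beta> (M v) h \<le> norm (M v) * norm h * K" using K(2)[of "M v" h] by simp
    also have "\<dots> \<le> (norm v * N) * (e * norm v) * K"
      using N K h by (intro mult_right_mono mult_mono) auto
    finally have 1: "\<beta> (M v) h \<le> e * (K * N) * (norm v)\<^sup>2" by (simp add: power2_eq_square algebra_simps)
    have "\<beta> h (M v) \<le> norm h * norm (M v) * K" using K(2)[of h "M v"] by simp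
    also have "\<dots> \<le> (e * norm v) * (norm v * N) * K"
      using N K h e by (intro mult_right_mono mult_mono) auto
    finally have 2: "\<beta> h (M v) \<le> e * (K * N) * (norm v)\<^sup>2" by (simp add: power2_eq_square algebra_simps)
    have "\<beta> h h \<le> norm h * norm h * K" using K(2)[of h h] by simp
    also have "\<dots> \<le> (e * norm v) * (1 * norm v) * K"
      using K h e by (intro mult_right_mono mult_mono order_trans[OF h]) auto
    finally have 3: "\<beta> h h \<le> e * K * (norm v)\<^sup>2" by (simp add: power2_eq_square algebra_simps)
    have "\<beta> (g x - g y) (g x - g y) = \<beta> (M v + h) (M v + h)" by (simp add: h_def)
    also have "\<dots> = \<beta> (M v) (M v) + \<beta> (M v) h + \<beta> h (M v) + \<beta> h h"
      by (simp add: \<beta>.add_left \<beta>.add_right)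
    also have "\<dots> \<le> \<beta> (M v) (M v) + e * (K * (2 * N + 1)) * (norm v)\<^sup>2"
      using 1 2 3 by (simp add: algebra_simps)
    also have "\<dots> \<le> \<beta> (M v) (M v) + c * (norm v)\<^sup>2"
      using eK by (intro add_left_mono mult_right_mono) auto
    also have "\<dots> \<le> \<rho> * \<beta> v v" using exp[of v] by simp
    finally show ?thesis by (simp add: v_def)
  qed
  have nonneg: "\<beta> (x - y) (x - y) \<ge> 0" if x: "x \<in> S" and y: "y \<in> S" for x y
  proof (rule ccontr)
    assume "\<not> ?thesis"
    then have neg: "\<beta> (x - y) (x - y) < 0" by simp
    define D where "D = (\<lambda>k. (g ^^ k) x - (g ^^ k) y)"
    have grow: "\<beta> (D k) (D k) \<le> \<rho> ^ k * \<beta> (x - y) (x - y)" for k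
    proof (induction k)
      case (Suc k)
      have "\<beta> (D (Suc k)) (D (Suc k)) \<le> \<rho> * \<beta> (D k) (D k)"
        using step[of "(g ^^ k) x" "(g ^^ k) y"] x y by (simp add: D_def S_def)
      also have "\<dots> \<le> \<rho> * (\<rho> ^ k * \<beta> (x - y) (x - y))"
        using Suc \<open>\<rho> > 1\<close> by (intro mult_left_mono) auto
      finally show ?case by simp
    qed (simp add: D_def)
    have bound: "- \<beta> (D k) (D k) \<le> d * d * K" for k
    proof -
      have "dist a ((g ^^ k) x) \<le> r" "dist a ((g ^^ k) y) \<le> r"
        using x y by (auto simp: S_def)
      then have "norm (D k) \<le> d"
        unfolding D_def dist_norm[symmetric]
        using dist_triangle3[of "(g ^^ k) x" "(g ^^ k) y" a] by (simp add: r_def)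
      then have "norm (D k) * norm (D k) * K \<le> d * d * K"
        using K d(1) by (intro mult_right_mono mult_mono) auto
      then show ?thesis using K(2)[of "D k" "D k"] by simp
    qed
    obtain k where "d * d * K / (- \<beta> (x - y) (x - y)) < \<rho> ^ k"
      using real_arch_pow[OF \<open>\<rho> > 1\<close>] by blast
    then have "d * d * K < \<rho> ^ k * (- \<beta> (x - y) (x - y))"
      using neg by (metis neg_0_less_iff_less pos_divide_less_eq)
    then show False using grow[of k] bound[of k] by simp
  qed
  have "closed S"
  proof -
    have "continuous_on UNIV (g ^^ k)" for k
    proof (induction k)
      case (Suc k)
      then show ?case
        using continuous_on_compose2[OF cont Suc] by simp
    qed (simp add: id_def)
    then have "closed ((g ^^ k) -` cball a r)" for k
      using continuous_on_closed_vimage[of UNIV "g ^^ k"] by simp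
    moreover have "S = (\<Inter>k. (g ^^ k) -` cball a r)" by (auto simp: S_def)
    ultimately show ?thesis by auto
  qed
  moreover have "S \<subseteq> cball a r"
  proof
    fix x assume "x \<in> S"
    then have "(g ^^ 0) x \<in> cball a r" unfolding S_def by blast
    then show "x \<in> cball a r" by simp
  qed
  ultimately have "compact S"
    using bounded_subset[OF bounded_cball] compact_eq_bounded_closed by blast
  then have "negligible S"
  proof (rule negligible_disjoint_translates)
    fix x t assume "x \<in> S" "x + t *\<^sub>R w \<in> S"
    then have "\<beta> (t *\<^sub>R w) (t *\<^sub>R w) \<ge> 0" using nonneg[of "x + t *\<^sub>R w" x] by simp
    then have "t * t * \<beta> w w \<ge> 0" by (simp add: \<beta>.scaleR_left \<beta>.scaleR_right mult.assoc)
    then show "t = 0" using w by (metis mult_eq_0_iff mult_le_0_iff mult_nonneg_nonpos2 not_le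
          order_antisym_conv zero_le_square less_imp_le)
  qed
  then show thesis using that[of r] d by (simp add: S_def r_def)
qed

lemma orthogonal_projection_subspace:
  fixes S :: "'a::euclidean_space set"
  assumes "subspace S"
  obtains P where "linear P" "\<And>x. P x \<in> S" "\<And>x y. y \<in> S \<Longrightarrow> (x - P x) \<bullet> y = 0"
proof -
  obtain B where B: "B \<subseteq> S" "pairwise orthogonal B" "\<And>x. x \<in> B \<Longrightarrow> norm x = 1"
    "independent B" "span B = S"
    using orthonormal_basis_subspace[OF assms] by metis
  have "finite B" using B(4) independent_imp_finite by blast
  define P where "P = (\<lambda>x. \<Sum>b\<in>B. (x \<bullet> b) *\<^sub>R b)"
  have "linear P"
    unfolding P_def by (intro linear_compose_sum ballI linearI) (auto simp: inner_add_left scaleR_add_left)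
  moreover have "P x \<in> S" for x
    unfolding P_def using B(1) assms by (intro subspace_sum) (auto intro: subspace_scale)
  moreover have "(x - P x) \<bullet> y = 0" if "y \<in> S" for x y
  proof -
    have "orthogonal (x - P x) b" if "b \<in> B" for b
    proof -
      have "P x \<bullet> b = (\<Sum>b'\<in>B. if b' = b then x \<bullet> b else 0)"
        unfolding P_def inner_sum_left
        using B(2) B(3)[OF that] that
        by (intro sum.cong) (auto simp: pairwise_def orthogonal_def norm_eq_1)
      then show ?thesis using \<open>finite B\<close> that by (simp add: orthogonal_def inner_diff_left)
    qed
    then have "orthogonal (x - P x) y"
      using orthogonal_to_span[of y B] that B(5) by blast
    then show ?thesis by (simp add: orthogonal_def)
  qed
  ultimately show thesis using that by blast
qed

section \<open>Symmetric forms\<close>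

lemma bounded_bilinear_linear_inner:
  fixes H P :: "'a::euclidean_space \<Rightarrow> 'a"
  assumes "linear H" "linear P"
  shows "bounded_bilinear (\<lambda>x y. x \<bullet> H y + k * (P x \<bullet> P y))"
  unfolding bilinear_conv_bounded_bilinear[symmetric] bilinear_def
  using assms
  by (auto intro!: linearI simp: linear_add linear_cmul inner_add_left inner_add_right algebra_simps)

text \<open>Take \<open>\<beta>\<close> to be the form of \<open>H\<close> plus a small multiple of the squared projection to the kernel
  of \<open>H\<close>: off the kernel the descent is strict by compactness, and on the kernel, where \<open>M\<close> is the
  identity, the factor \<open>\<rho> > 1\<close> provides the gap.\<close>

lemma symmetric_form_expanding:
  fixes H M :: "'a::euclidean_space \<Rightarrow> 'a"
  assumes lH: "linear H" and sym: "\<And>x y. H x \<bullet> y = x \<bullet> H y" and lM: "linear M"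
    and fixed: "\<And>x. H x = 0 \<Longrightarrow> M x = x"
    and descent: "\<And>x. M x \<bullet> H (M x) \<le> x \<bullet> H x"
    and strict: "\<And>x. M x \<bullet> H (M x) = x \<bullet> H x \<Longrightarrow> H x = 0"
    and w: "w \<bullet> H w < 0"
  obtains \<beta> \<rho> c u where "bounded_bilinear \<beta>" "\<rho> > (1::real)" "c > 0"
    "\<And>x. \<beta> (M x) (M x) \<le> \<rho> * \<beta> x x - c * (norm x)\<^sup>2" "\<beta> u u < (0::real)"
proof -
  have "subspace {x. H x = 0}"
    by (rule subspaceI) (auto simp: linear_0[OF lH] linear_add[OF lH] linear_cmul[OF lH])
  then obtain P where P: "linear P" "\<And>x. H (P x) = 0" "\<And>x y. H y = 0 \<Longrightarrow> (x - P x) \<bullet> y = 0"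
    by (rule orthogonal_projection_subspace) simp
  have Pid: "P y = y" if "H y = 0" for y
  proof -
    have "H (y - P y) = 0" using P(2) that by (simp add: linear_diff[OF lH])
    from P(3)[OF this, of y] show ?thesis by simp
  qed
  \<comment> \<open>By symmetry a kernel component is invisible to the form, so only the component
    orthogonal to the kernel counts.\<close>
  have shift: "(k + v) \<bullet> H (k + v) = v \<bullet> H v" if "H k = 0" for k v
    using that sym[of k v] by (simp add: linear_add[OF lH] inner_add_left)
  obtain c0 where c0: "c0 > 0" "\<And>v. P v = 0 \<Longrightarrow> M v \<bullet> H (M v) \<le> v \<bullet> H v - c0 * (norm v)\<^sup>2"
  proof -
    define V where "V = sphere 0 1 \<inter> {v. P v = 0}"
    have contH: "continuous_on S H" and contM: "continuous_on S M" and contP: "continuous_on S P" for S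
      using lH lM P(1) by (simp_all add: linear_continuous_on linear_conv_bounded_linear)
    have "closed {v. P v = 0}"
      using continuous_closed_preimage_constant[OF contP closed_UNIV, of 0] by simp
    then have "compact V" unfolding V_def by (intro compact_Int_closed) auto
    have cont: "continuous_on V (\<lambda>v. v \<bullet> H v - M v \<bullet> H (M v))"
      by (intro continuous_intros contH contM continuous_on_compose2[OF contH[of UNIV] contM]) auto
    have pos: "v \<bullet> H v - M v \<bullet> H (M v) > 0" if "v \<in> V" for v
    proof (rule ccontr)
      assume "\<not> ?thesis"
      then have "H v = 0" using descent[of v] strict[of v] by simp
      then have "v = 0" using Pid[of v] that by (simp add: V_def)
      then show False using that by (simp add: V_def)
    qed
    \<comment> \<open>The decrease is positive on the unit sphere of the orthogonal complement of
      the kernel and attains its minimum there. If that sphere is empty, any positive constant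
      serves.\<close>
    obtain c0 where "c0 > 0" and c0: "\<And>v. v \<in> V \<Longrightarrow> c0 \<le> v \<bullet> H v - M v \<bullet> H (M v)"
    proof (cases "V = {}")
      case False
      then obtain v0 where "v0 \<in> V" "\<And>v. v \<in> V \<Longrightarrow> v0 \<bullet> H v0 - M v0 \<bullet> H (M v0) \<le> v \<bullet> H v - M v \<bullet> H (M v)"
        using continuous_attains_inf[OF \<open>compact V\<close> _ cont] by blast
      then show thesis using pos that by blast
    qed (auto intro: that[of 1])
    have "M v \<bullet> H (M v) \<le> v \<bullet> H v - c0 * (norm v)\<^sup>2" if "P v = 0" for v
    proof (cases "v = 0")
      case False
      define n where "n = norm v"
      have n: "n > 0" using False by (simp add: n_def)
      define z where "z = (1 / n) *\<^sub>R v"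
      have v: "v = n *\<^sub>R z" using n by (simp add: z_def)
      have "z \<in> V" using that n by (simp add: V_def z_def n_def linear_cmul[OF P(1)])
      then have "n * n * c0 \<le> n * n * (z \<bullet> H z - M z \<bullet> H (M z))"
        using n by (intro mult_left_mono c0) auto
      moreover have "v \<bullet> H v = n * n * (z \<bullet> H z)" "M v \<bullet> H (M v) = n * n * (M z \<bullet> H (M z))"
        by (simp_all add: v linear_cmul[OF lH] linear_cmul[OF lM])
      ultimately show ?thesis by (simp add: n_def power2_eq_square algebra_simps)
    qed (simp add: linear_0[OF lM])
    then show thesis using that \<open>c0 > 0\<close> by blast
  qed
  have lPM: "linear (\<lambda>v. P (M v))" using linear_compose[OF lM P(1)] by (simp add: comp_def)
  obtain C where C: "C > 0" "\<And>v. norm (P (M v)) \<le> C * norm v"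
    using linear_bounded_pos[OF lPM] by blast
  obtain h where h: "h > 0" "\<And>v. norm (H v) \<le> h * norm v"
    using linear_bounded_pos[OF lH] by blast
  \<comment> \<open>The gain \<open>c0\<close> is spent in quarters: \<open>e\<close> makes the
    extra \<open>e * (v \<bullet> H v)\<close> cost at most \<open>c0 / 4\<close>, and
    \<open>k\<close> makes the new term cost at most \<open>c0 / 4\<close> on the complement. The
    remaining \<open>c0 / 2\<close> there, and \<open>k * e / 2\<close> on the kernel, give
    \<open>c\<close>.\<close>
  define e where "e = c0 / (4 * h)"
  define k where "k = c0 / 4 / (C\<^sup>2 + 2 * C\<^sup>2 / e)"
  define c where "c = min (c0 / 2) (k * e / 2)"
  have e: "e > 0" using c0 h by (simp add: e_def)
  have Ce: "C\<^sup>2 + 2 * C\<^sup>2 / e > 0" using C e by (simp add: add_pos_pos)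
  have k: "k > 0" using c0 Ce by (simp add: k_def)
  have kc0: "k * (C\<^sup>2 + 2 * C\<^sup>2 / e) = c0 / 4"
    unfolding k_def using nonzero_eq_divide_eq[THEN iffD1, OF less_imp_neq[OF Ce, symmetric] refl] .
  have c: "c > 0" using c0 k e by (simp add: c_def)
  define \<beta> where "\<beta> = (\<lambda>x y. x \<bullet> H y + k * (P x \<bullet> P y))"
  have "\<beta> (M x) (M x) \<le> (1 + e) * \<beta> x x - c * (norm x)\<^sup>2" for x
  proof -
    define y v where "y = P x" and "v = x - P x"
    have Hy: "H y = 0" and Py: "P y = y" and My: "M y = y"
      using P(2) Pid fixed by (auto simp: y_def)
    have x: "x = y + v" by (simp add: y_def v_def)
    have Pv: "P v = 0" using Py by (simp add: v_def y_def linear_diff[OF P(1)])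
    define Y V where "Y = norm y" and "V = norm v"
    have YV: "Y \<ge> 0" "V \<ge> 0" by (simp_all add: Y_def V_def)
    have nx: "(norm x)\<^sup>2 = Y\<^sup>2 + V\<^sup>2"
    proof -
      have "v \<bullet> y = 0" unfolding v_def by (rule P(3)[OF Hy])
      then show ?thesis
        unfolding x Y_def V_def
        by (simp add: power2_norm_eq_inner inner_add_left inner_add_right inner_commute)
    qed
    have Q: "\<bar>v \<bullet> H v\<bar> \<le> h * V\<^sup>2"
    proof -
      have "\<bar>v \<bullet> H v\<bar> \<le> norm v * norm (H v)" by (rule Cauchy_Schwarz_ineq2)
      also have "\<dots> \<le> norm v * (h * norm v)" using h by (intro mult_left_mono) auto
      finally show ?thesis by (simp add: V_def power2_eq_square algebra_simps)
    qed
    have PM: "(norm (y + P (M v)))\<^sup>2 \<le> (Y + C * V)\<^sup>2"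
      using C(2)[of v] by (intro power_mono order_trans[OF norm_triangle_ineq]) (auto simp: Y_def V_def)
    have "\<beta> (M x) (M x) = M v \<bullet> H (M v) + k * (norm (y + P (M v)))\<^sup>2"
      using shift[OF Hy, of "M v"]
      by (simp add: \<beta>_def x linear_add[OF lM] My linear_add[OF P(1)] Py power2_norm_eq_inner)
    also have "\<dots> \<le> v \<bullet> H v - c0 * V\<^sup>2 + k * (Y + C * V)\<^sup>2"
      using c0(2)[OF Pv] PM k by (intro add_mono mult_left_mono) (auto simp: V_def)
    finally have 1: "\<beta> (M x) (M x) \<le> v \<bullet> H v - c0 * V\<^sup>2 + k * (Y + C * V)\<^sup>2" .
    have 2: "\<beta> x x = v \<bullet> H v + k * Y\<^sup>2"
      using shift[OF Hy, of v]
      by (simp add: \<beta>_def x linear_add[OF P(1)] Py Pv Y_def power2_norm_eq_inner)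
    have eq: "e * (h * V\<^sup>2) = c0 / 4 * V\<^sup>2" using h by (simp add: e_def)
    have eQ: "- (e * (v \<bullet> H v)) \<le> c0 / 4 * V\<^sup>2"
      using mult_left_mono[OF Q, of e] e abs_ge_minus_self[of "v \<bullet> H v"]
      unfolding eq[symmetric] by (smt (verit) mult_left_mono mult_minus_right)
    \<comment> \<open>A weighted arithmetic-geometric mean inequality: the mixed term is absorbed
      with weight \<open>e / 2\<close> on the kernel part, half of the growth available
      there.\<close>
    have "e / 2 * Y\<^sup>2 + 2 * C\<^sup>2 / e * V\<^sup>2 - 2 * C * Y * V = (e * Y - 2 * C * V)\<^sup>2 / (2 * e)"
      using e by (simp add: power2_eq_square field_simps)
    also have "\<dots> \<ge> 0" using e by simp
    finally have amgm: "2 * C * Y * V \<le> e / 2 * Y\<^sup>2 + 2 * C\<^sup>2 / e * V\<^sup>2" by simp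
    have "k * (Y + C * V)\<^sup>2 = k * (Y\<^sup>2 + 2 * C * Y * V + C\<^sup>2 * V\<^sup>2)"
      by (simp add: power2_eq_square algebra_simps)
    also have "\<dots> \<le> k * (Y\<^sup>2 + (e / 2 * Y\<^sup>2 + 2 * C\<^sup>2 / e * V\<^sup>2) + C\<^sup>2 * V\<^sup>2)"
      using amgm k by (intro mult_left_mono) auto
    also have "\<dots> = k * Y\<^sup>2 + k * e / 2 * Y\<^sup>2 + k * (C\<^sup>2 + 2 * C\<^sup>2 / e) * V\<^sup>2"
      by (simp add: algebra_simps)
    finally have 3: "k * (Y + C * V)\<^sup>2 \<le> k * Y\<^sup>2 + k * e / 2 * Y\<^sup>2 + c0 / 4 * V\<^sup>2"
      unfolding kc0 .
    have 4: "c * Y\<^sup>2 \<le> k * e / 2 * Y\<^sup>2" "c * V\<^sup>2 \<le> c0 / 2 * V\<^sup>2"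
      by (intro mult_right_mono; simp add: c_def)+
    have "(1 + e) * \<beta> x x = v \<bullet> H v + k * Y\<^sup>2 + e * (v \<bullet> H v) + k * e * Y\<^sup>2"
      unfolding 2 by (simp add: algebra_simps)
    then show ?thesis
      unfolding nx using 1 3 4 eQ by (simp add: algebra_simps)
  qed
  moreover have "bounded_bilinear \<beta>"
    unfolding \<beta>_def by (rule bounded_bilinear_linear_inner[OF lH P(1)])
  \<comment> \<open>Removing the kernel part of \<open>w\<close> leaves the form of \<open>H\<close>
    unchanged and makes the added term vanish.\<close>
  moreover have "\<beta> (w - P w) (w - P w) < 0"
    using w shift[OF P(2)[of w], of "w - P w"] Pid[OF P(2)]
    by (simp add: \<beta>_def linear_diff[OF P(1)])
  ultimately show thesis using that[of \<beta> "1 + e" c "w - P w"] e c by auto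
qed

text \<open>Existence and finiteness of eigenvalues are needed because \<^const>\<open>Min\<close> in \<^const>\<open>lambda_min\<close>
  is unspecified on empty and infinite sets.\<close>

lemma symmetric_linear_eigenvector_exists:
  fixes H :: "'a::euclidean_space \<Rightarrow> 'a"
  assumes lH: "linear H" and sym: "\<And>x y. H x \<bullet> y = x \<bullet> H y"
  obtains l v where "v \<noteq> 0" "H v = l *\<^sub>R v"
proof -
  have "continuous_on (sphere 0 1) (\<lambda>x. x \<bullet> H x)"
    using lH by (intro continuous_intros linear_continuous_on) (simp add: linear_conv_bounded_linear)
  then obtain v where v: "norm v = 1" "\<And>x. norm x = 1 \<Longrightarrow> x \<bullet> H x \<le> v \<bullet> H v"
    using continuous_attains_sup[OF compact_sphere, of 0 1 "\<lambda>x. x \<bullet> H x"] by auto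
  define l where "l = v \<bullet> H v"
  define q where "q = (\<lambda>x. l * (x \<bullet> x) - x \<bullet> H x)"
  have q: "q x \<ge> 0" for x
  proof (cases "x = 0")
    case False
    have "x \<bullet> H x = (norm x)\<^sup>2 * ((x /\<^sub>R norm x) \<bullet> H (x /\<^sub>R norm x))"
      using False by (simp add: linear_cmul[OF lH] power2_eq_square field_simps)
    also have "\<dots> \<le> (norm x)\<^sup>2 * l"
      unfolding l_def using False by (intro mult_left_mono v(2)) auto
    finally show ?thesis by (simp add: q_def power2_norm_eq_inner mult.commute)
  qed (simp add: q_def linear_0[OF lH])
  \<comment> \<open>The maximiser \<open>v\<close> of the form on the unit sphere is the
    eigenvector. The form \<open>q\<close> is nonnegative and vanishes at \<open>v\<close>; if the
    residual \<open>z\<close> were nonzero, moving from \<open>v\<close> slightly against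
    \<open>z\<close> would make \<open>q\<close> negative.\<close>
  define z where "z = l *\<^sub>R v - H v"
  have quad: "q (v + t *\<^sub>R z) = 2 * t * (z \<bullet> z) + t * t * q z" for t
  proof -
    have qv: "l * (v \<bullet> v) - v \<bullet> H v = 0" using v(1) by (simp add: l_def norm_eq_1)
    have "z \<bullet> z = l * (v \<bullet> z) - v \<bullet> H z"
      using sym[of v z] by (simp add: z_def inner_diff_left)
    moreover have "z \<bullet> H v = v \<bullet> H z" using sym[of z v] by (metis inner_commute)
    moreover have "q (v + t *\<^sub>R z) = (l * (v \<bullet> v) - v \<bullet> H v) + t * (2 * (l * (v \<bullet> z)) - v \<bullet> H z - z \<bullet> H v)
        + t * t * q z"
      by (simp add: q_def linear_add[OF lH] linear_cmul[OF lH] inner_add_left inner_add_right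
          inner_commute[of z v] algebra_simps)
    ultimately show ?thesis using qv by simp
  qed
  have "z = 0"
  proof (rule ccontr)
    assume "z \<noteq> 0"
    then have zz: "z \<bullet> z > 0" by simp
    \<comment> \<open>Chosen so that \<open>t * (q z + 1)\<close> equals
      \<open>- (z \<bullet> z)\<close>; the summand 1 excludes division by zero.\<close>
    define t where "t = - (z \<bullet> z) / (q z + 1)"
    have qz: "q z + 1 > 0" using q[of z] by simp
    have "t < 0" using zz qz by (simp add: t_def)
    have "t * (q z + 1) = - (z \<bullet> z)" using qz by (simp add: t_def)
    then have "2 * (z \<bullet> z) + t * q z = z \<bullet> z - t" by (simp add: algebra_simps)
    then have "2 * (z \<bullet> z) + t * q z > 0" using zz \<open>t < 0\<close> by linarith
    then have "t * (2 * (z \<bullet> z) + t * q z) < 0" using \<open>t < 0\<close> by (rule mult_neg_pos[rotated])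
    then have "q (v + t *\<^sub>R z) < 0" unfolding quad by (simp add: algebra_simps)
    then show False using q[of "v + t *\<^sub>R z"] by simp
  qed
  then have "H v = l *\<^sub>R v" by (simp add: z_def)
  moreover have "v \<noteq> 0" using v(1) by auto
  ultimately show thesis using that by blast
qed

text \<open>Eigenvectors for distinct eigenvalues are orthogonal, and an orthogonal family in a
  Euclidean space is finite.\<close>

lemma finite_eigenvalues_symmetric:
  fixes H :: "'a::euclidean_space \<Rightarrow> 'a"
  assumes sym: "\<And>x y. H x \<bullet> y = x \<bullet> H y"
  shows "finite {l. \<exists>v. v \<noteq> 0 \<and> H v = l *\<^sub>R v}" (is "finite ?E")
proof -
  obtain V where V: "\<And>l. l \<in> ?E \<Longrightarrow> V l \<noteq> 0 \<and> H (V l) = l *\<^sub>R V l"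
    using that[of "\<lambda>l. SOME v. v \<noteq> 0 \<and> H v = l *\<^sub>R v"] someI_ex by (smt (verit) mem_Collect_eq)
  have orth: "V l \<bullet> V m = 0" if "l \<in> ?E" "m \<in> ?E" "l \<noteq> m" for l m
  proof -
    have "l * (V l \<bullet> V m) = m * (V l \<bullet> V m)"
      using sym[of "V l" "V m"] V[OF that(1)] V[OF that(2)] by simp
    then show ?thesis using that(3) by simp
  qed
  have "pairwise orthogonal (V ` ?E)"
    using orth by (fastforce simp: pairwise_def orthogonal_def)
  then have "finite (V ` ?E)" by (rule pairwise_orthogonal_imp_finite)
  moreover have "inj_on V ?E"
  proof (rule inj_onI, rule ccontr)
    fix l m assume lm: "l \<in> ?E" "m \<in> ?E" "V l = V m" "l \<noteq> m"
    from orth[OF lm(1,2,4)] lm(3) have "V l = 0" by simp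
    then show False using V[OF lm(1)] by simp
  qed
  ultimately show ?thesis by (rule finite_imageD)
qed

lemma lambda_min_negative_direction:
  fixes A :: "real^'n^'n"
  assumes sym: "\<And>x y. (A *v x) \<bullet> y = x \<bullet> (A *v y)" and neg: "lambda_min A < 0"
  obtains w where "w \<bullet> (A *v w) < 0"
proof -
  let ?E = "{l. \<exists>v. v \<noteq> 0 \<and> A *v v = l *\<^sub>R v}"
  have "?E \<noteq> {}"
    using symmetric_linear_eigenvector_exists[OF matrix_vector_mul_linear sym] by blast
  then have "lambda_min A \<in> ?E"
    unfolding lambda_min_def by (intro Min_in finite_eigenvalues_symmetric[OF sym])
  then obtain v where "v \<noteq> 0" "A *v v = lambda_min A *\<^sub>R v" by blast
  then have "v \<bullet> (A *v v) < 0" using neg by (simp add: mult_neg_pos)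
  then show thesis by (rule that)
qed

section \<open>A single mirror descent block step\<close>

lemma gradf_eqI:
  assumes "(f has_derivative (\<lambda>h. h \<bullet> D)) (at x)"
  shows "gradf f x = D"
  unfolding gradf_def gderiv_def
proof (rule the_equality)
  show "(f has_derivative (\<lambda>h. h \<bullet> D)) (at x)" by (rule assms)
  fix D' assume "(f has_derivative (\<lambda>h. h \<bullet> D')) (at x)"
  then have "(\<lambda>h. h \<bullet> D') = (\<lambda>h. h \<bullet> D)" using assms by (rule has_derivative_unique)
  then show "D' = D" by (metis vector_eq_ldot)
qed

lemma has_derivative_gradf:
  assumes "f differentiable (at x)"
  shows "(f has_derivative (\<lambda>h. h \<bullet> gradf f x)) (at x)"
proof -
  obtain f' where f': "(f has_derivative f') (at x)" using assms by (auto simp: differentiable_def)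
  then have "linear f'" by (rule has_derivative_linear)
  then have "f' = (\<lambda>h. h \<bullet> adjoint f' 1)" by (simp add: adjoint_works)
  then have "(f has_derivative (\<lambda>h. h \<bullet> adjoint f' 1)) (at x)" using f' by simp
  then show ?thesis using gradf_eqI by metis
qed

lemma C2_has_derivative: "C2 f \<Longrightarrow> (f has_derivative (\<lambda>h. h \<bullet> gradf f x)) (at x)"
  by (simp add: C2_def has_derivative_gradf)

lemma C2_gradf_has_derivative:
  "C2 f \<Longrightarrow> (gradf f has_derivative frechet_derivative (gradf f) (at x)) (at x)"
  by (simp add: C2_def frechet_derivative_works[symmetric])

lemma C2_gradf_strict_derivative:
  "C2 f \<Longrightarrow> has_strict_derivative (gradf f) (frechet_derivative (gradf f) (at a)) a"
  by (rule has_strict_derivative_C1[OF C2_gradf_has_derivative]) (auto simp: C2_def)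

text \<open>Test the inequality at \<open>a + t *\<^sub>R v\<close> and \<open>a\<close>, divide by
  \<open>t\<^sup>2\<close> and let the error tend to 0. The map \<open>P\<close> allows monotonicity
  measured only along a block, as for the gradient of the mirror potential.\<close>

lemma strict_derivative_monotone:
  fixes F :: "'a::real_inner \<Rightarrow> 'a"
  assumes F: "has_strict_derivative F F' a"
    and mono: "\<And>x y. m * (norm (P (x - y)))\<^sup>2 \<le> (F x - F y) \<bullet> (x - y)" and P: "linear P"
  shows "m * (norm (P v))\<^sup>2 \<le> F' v \<bullet> v"
proof (cases "v = 0")
  case False
  have lin: "linear F'" using F by (simp add: has_strict_derivative_def bounded_linear.linear)
  show ?thesis
  proof (rule field_le_epsilon)
    fix e :: real assume "e > 0"
    define e' where "e' = e / (norm v)\<^sup>2"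
    have "e' > 0" using \<open>e > 0\<close> False by (simp add: e'_def)
    then obtain d where d: "d > 0" "\<And>x y. x \<in> ball a d \<Longrightarrow> y \<in> ball a d \<Longrightarrow>
        norm (F x - F y - F' (x - y)) \<le> e' * norm (x - y)"
      using has_strict_derivativeD[OF F] by metis
    define t where "t = d / (2 * norm v)"
    have t: "t > 0" "t * norm v < d" using d False by (auto simp: t_def)
    define x where "x = a + t *\<^sub>R v"
    have x: "x \<in> ball a d" "x - a = t *\<^sub>R v" using t by (auto simp: x_def dist_norm)
    have 1: "norm (F x - F a - t *\<^sub>R F' v) \<le> e' * (t * norm v)"
      using d(2)[OF x(1), of a] d(1) t by (simp add: x(2) linear_cmul[OF lin])
    have "t * t * (m * (norm (P v))\<^sup>2) \<le> (F x - F a) \<bullet> (t *\<^sub>R v)"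
      using mono[of x a] t by (simp add: x(2) linear_cmul[OF P] power2_eq_square mult_ac)
    also have "\<dots> = (F x - F a - t *\<^sub>R F' v) \<bullet> (t *\<^sub>R v) + t * t * (F' v \<bullet> v)"
      by (simp add: inner_diff_left algebra_simps)
    also have "\<dots> \<le> e' * (t * norm v) * (t * norm v) + t * t * (F' v \<bullet> v)"
    proof -
      have "(F x - F a - t *\<^sub>R F' v) \<bullet> (t *\<^sub>R v) \<le> norm (F x - F a - t *\<^sub>R F' v) * norm (t *\<^sub>R v)"
        by (rule norm_cauchy_schwarz)
      also have "\<dots> \<le> e' * (t * norm v) * norm (t *\<^sub>R v)" using 1 by (rule mult_right_mono) simp
      finally show ?thesis using t by simp
    qed
    also have "\<dots> = t * t * (F' v \<bullet> v + e)"
      using False by (simp add: e'_def power2_eq_square field_simps)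
    finally show "m * (norm (P v))\<^sup>2 \<le> F' v \<bullet> v + e"
      using t by (simp add: mult_le_cancel_left)
  qed
qed (use F P in \<open>simp add: has_strict_derivative_def linear_0 bounded_linear.linear\<close>)

text \<open>Implicit differentiation of \<open>A (G x) = B x\<close>: expansion of \<open>A\<close>
  makes \<open>G\<close> Lipschitz, subtracting the linearisations of \<open>A\<close> and
  \<open>B\<close> bounds \<open>A'\<close> of the error of \<open>G\<close>, and expansion of
  \<open>A'\<close> returns this to the error itself.\<close>

lemma has_strict_derivative_implicit:
  fixes A B G :: "'a::real_normed_vector \<Rightarrow> 'a"
  assumes A: "has_strict_derivative A A' p" and B: "has_strict_derivative B B' p"
    and "m > 0" and expA: "\<And>x y. m * norm (x - y) \<le> norm (A x - A y)"
    and expA': "\<And>v. m * norm v \<le> norm (A' v)"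
    and AG: "\<And>x. A (G x) = B x" and Gp: "G p = p"
    and T: "bounded_linear T" "\<And>v. A' (T v) = B' v"
  shows "has_strict_derivative G T p"
  unfolding has_strict_derivative_def
proof (intro conjI allI impI T(1))
  obtain d1 C where d1: "d1 > 0" "C > 0"
    "\<And>x y. x \<in> ball p d1 \<Longrightarrow> y \<in> ball p d1 \<Longrightarrow> norm (B x - B y) \<le> C * norm (x - y)"
    using has_strict_derivative_lipschitz[OF B] by metis
  have lipG: "norm (G x - G y) \<le> C / m * norm (x - y)" if "x \<in> ball p d1" "y \<in> ball p d1" for x y
    using order_trans[OF expA[of "G x" "G y"]] d1(3)[OF that] \<open>m > 0\<close>
    by (simp add: AG field_simps)
  fix e :: real assume "e > 0"
  \<comment> \<open>Each linearisation may contribute \<open>e * m / 2\<close>; for \<open>A\<close>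
    the Lipschitz constant \<open>C / m\<close> of \<open>G\<close> enters as well.\<close>
  define e1 where "e1 = e * m / (2 * (C / m))"
  define e2 where "e2 = e * m / 2"
  have pos: "e1 > 0" "e2 > 0" using \<open>e > 0\<close> \<open>m > 0\<close> d1 by (simp_all add: e1_def e2_def)
  obtain d2 where d2: "d2 > 0" "\<And>x y. x \<in> ball p d2 \<Longrightarrow> y \<in> ball p d2 \<Longrightarrow>
      norm (A x - A y - A' (x - y)) \<le> e1 * norm (x - y)"
    using has_strict_derivativeD[OF A pos(1)] by metis
  obtain d3 where d3: "d3 > 0" "\<And>x y. x \<in> ball p d3 \<Longrightarrow> y \<in> ball p d3 \<Longrightarrow>
      norm (B x - B y - B' (x - y)) \<le> e2 * norm (x - y)"
    using has_strict_derivativeD[OF B pos(2)] by metis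
  define d where "d = min (min d1 d3) (d2 / (C / m))"
  have "d > 0" using d1 d2 d3 \<open>m > 0\<close> by (simp add: d_def)
  have linA': "linear A'" using A by (simp add: has_strict_derivative_def bounded_linear.linear)
  have "norm (G x - G y - T (x - y)) \<le> e * norm (x - y)" if x: "x \<in> ball p d" and y: "y \<in> ball p d" for x y
  proof -
    have Gin: "G z \<in> ball p d2" if "z \<in> ball p d" for z
    proof -
      have "norm (G p - G z) \<le> C / m * norm (p - z)"
        using d1(1) that by (intro lipG) (auto simp: d_def)
      also have "\<dots> < d2"
        using that d1(2) \<open>m > 0\<close> by (auto simp: d_def dist_norm field_simps)
      finally show ?thesis by (simp add: dist_norm Gp)
    qed
    have "norm (A (G x) - A (G y) - A' (G x - G y)) \<le> e1 * norm (G x - G y)"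
      by (intro d2(2) Gin x y)
    also have "\<dots> \<le> e1 * (C / m * norm (x - y))"
      using pos x y by (intro mult_left_mono lipG) (auto simp: d_def)
    also have "\<dots> = e * m / 2 * norm (x - y)"
      using d1 \<open>m > 0\<close> by (simp add: e1_def)
    finally have 1: "norm (B x - B y - A' (G x - G y)) \<le> e * m / 2 * norm (x - y)"
      by (simp add: AG)
    have 2: "norm (B x - B y - B' (x - y)) \<le> e * m / 2 * norm (x - y)"
      using d3(2)[of x y] x y by (simp add: d_def e2_def)
    have "m * norm (G x - G y - T (x - y)) \<le> norm (A' (G x - G y - T (x - y)))" by (rule expA')
    also have "A' (G x - G y - T (x - y)) = (B x - B y - B' (x - y)) - (B x - B y - A' (G x - G y))"
      by (simp add: linear_diff[OF linA'] T(2))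
    also have "norm ((B x - B y - B' (x - y)) - (B x - B y - A' (G x - G y)))
        \<le> e * m / 2 * norm (x - y) + e * m / 2 * norm (x - y)"
      by (rule order_trans[OF norm_triangle_ineq4 add_mono[OF 2 1]])
    also have "\<dots> = m * (e * norm (x - y))" by simp
    finally show ?thesis using \<open>m > 0\<close> by simp
  qed
  then show "\<exists>d>0. \<forall>x\<in>ball p d. \<forall>y\<in>ball p d. norm (G x - G y - T (x - y)) \<le> e * norm (x - y)"
    using \<open>d > 0\<close> by blast
qed

text \<open>A block enters through its orthogonal projection \<pi>. The potential lives on the whole
  space but depends only on the projected point, and its strong convexity is required only on the
  block.\<close>

locale mirror_block =
  fixes f \<phi> :: "real^'n \<Rightarrow> real" and \<pi> :: "real^'n \<Rightarrow> real^'n" and L \<mu> \<alpha> :: real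
  assumes f_C2: "C2 f" and f_lip: "norm (gradf f x - gradf f y) \<le> L * norm (x - y)"
    and L_pos: "L > 0" and \<alpha>_pos: "\<alpha> > 0" and \<alpha>_less: "\<alpha> * L < \<mu>"
    and \<pi>_linear: "linear \<pi>" and \<pi>_idem: "\<pi> (\<pi> x) = \<pi> x" and \<pi>_sym: "\<pi> x \<bullet> y = x \<bullet> \<pi> y"
    and \<phi>_C2: "C2 \<phi>" and \<phi>_\<pi>: "\<phi> (\<pi> x) = \<phi> x"
    and \<phi>_sc: "strongly_convex_on (range \<pi>) \<phi> \<mu>"
begin

abbreviation "H a \<equiv> frechet_derivative (gradf f) (at a)"

lemma \<mu>_pos: "\<mu> > 0"
  using \<alpha>_less L_pos \<alpha>_pos by (meson dual_order.strict_trans mult_pos_pos)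

lemma \<pi>_diff: "\<pi> (x - y) = \<pi> x - \<pi> y"
  by (rule linear_diff[OF \<pi>_linear])

lemma norm_split: "(norm x)\<^sup>2 = (norm (\<pi> x))\<^sup>2 + (norm (x - \<pi> x))\<^sup>2"
  using \<pi>_sym[of x "\<pi> x"] \<pi>_sym[of x x]
  by (simp add: power2_norm_eq_inner inner_diff_left inner_diff_right \<pi>_idem inner_commute)

text \<open>The chain rule for \<phi> composed with \<pi>, where symmetry moves \<pi> to the
  gradient. Hence the gradient lies in the block and sees only the block component of its
  argument.\<close>

lemma gradf_\<phi>: "\<pi> (gradf \<phi> (\<pi> x)) = gradf \<phi> x"
proof -
  have "((\<lambda>x. \<phi> (\<pi> x)) has_derivative (\<lambda>h. \<pi> h \<bullet> gradf \<phi> (\<pi> x))) (at x)"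
    by (rule has_derivative_compose[OF linear_imp_has_derivative[OF \<pi>_linear] C2_has_derivative[OF \<phi>_C2]])
  then have "(\<phi> has_derivative (\<lambda>h. h \<bullet> \<pi> (gradf \<phi> (\<pi> x)))) (at x)" by (simp add: \<phi>_\<pi> \<pi>_sym)
  then show ?thesis by (rule gradf_eqI[symmetric])
qed

lemma gradf_\<phi>_range: "\<pi> (gradf \<phi> x) = gradf \<phi> x"
  by (metis gradf_\<phi> \<pi>_idem)

lemma gradf_\<phi>_\<pi>: "gradf \<phi> (\<pi> x) = gradf \<phi> x"
  by (metis gradf_\<phi> gradf_\<phi>_range)

lemma gradf_\<phi>_monotone: "\<mu> * (norm (\<pi> (x - y)))\<^sup>2 \<le> (gradf \<phi> x - gradf \<phi> y) \<bullet> (x - y)"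
proof -
  have "\<phi> y \<ge> \<phi> x + gradf \<phi> x \<bullet> (\<pi> y - \<pi> x) + \<mu> / 2 * (norm (\<pi> y - \<pi> x))\<^sup>2" for x y
    using \<phi>_sc unfolding strongly_convex_on_def by (metis \<phi>_\<pi> gradf_\<phi>_\<pi> rangeI)
  from this[of x y] this[of y x]
  have "\<mu> * (norm (\<pi> x - \<pi> y))\<^sup>2 \<le> (gradf \<phi> x - gradf \<phi> y) \<bullet> (\<pi> x - \<pi> y)"
    by (simp add: inner_diff_left inner_diff_right norm_minus_commute)
  also have "\<dots> = \<pi> (gradf \<phi> x - gradf \<phi> y) \<bullet> (x - y)" by (simp only: \<pi>_sym \<pi>_diff[of x y])
  finally show ?thesis by (simp add: \<pi>_diff gradf_\<phi>_range)
qed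

text \<open>The mirror step solves \<open>A (step x) = B x\<close>; the block equation only involves the range of \<open>\<pi>\<close>,
  and the term \<open>\<kappa> *\<^sub>R (x - \<pi> x)\<close> extends it to the whole space. The weight \<open>\<kappa>\<close> is chosen by
  completing the square so that both \<open>A\<close> and \<open>B\<close> are strongly monotone with constant \<open>m\<close>.\<close>

definition "m = (\<mu> - \<alpha> * L) / 2"
definition "\<kappa> = m + (\<alpha> * L)\<^sup>2 / (4 * m)"
definition "A x = \<kappa> *\<^sub>R (x - \<pi> x) + gradf \<phi> x"
definition "B x = A x - \<alpha> *\<^sub>R \<pi> (gradf f x)"

lemma m_pos: "m > 0" using \<alpha>_less by (simp add: m_def)

text \<open>Split \<open>x - y\<close> into its block part, of norm \<open>z\<close>, and the rest,
  of norm \<open>v\<close>. Then \<open>A\<close> contributes at least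
  \<open>\<kappa> * v\<^sup>2 + \<mu> * z\<^sup>2\<close>, and the gradient term in \<open>B\<close>
  costs at most \<open>\<alpha> * L * (z + v) * z\<close>, because a block of the gradient also
  varies with the other coordinates.\<close>

lemma A_monotone: "m * (norm (x - y))\<^sup>2 \<le> (A x - A y) \<bullet> (x - y)"
  and B_monotone: "m * (norm (x - y))\<^sup>2 \<le> (B x - B y) \<bullet> (x - y)"
proof -
  define v z where "v = norm ((x - y) - \<pi> (x - y))" and "z = norm (\<pi> (x - y))"
  have vz: "v \<ge> 0" "z \<ge> 0" by (simp_all add: v_def z_def)
  have n: "(norm (x - y))\<^sup>2 = z\<^sup>2 + v\<^sup>2" by (simp add: v_def z_def norm_split[of "x - y"])
  have "((x - \<pi> x) - (y - \<pi> y)) \<bullet> (x - y) = v\<^sup>2"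
  proof -
    have "((x - \<pi> x) - (y - \<pi> y)) = (x - y) - \<pi> (x - y)" by (simp add: \<pi>_diff)
    moreover have "(d - \<pi> d) \<bullet> d = (norm (d - \<pi> d))\<^sup>2" for d
      using \<pi>_sym[of d "\<pi> d"] \<pi>_sym[of d d]
      by (simp add: power2_norm_eq_inner inner_diff_left inner_diff_right \<pi>_idem inner_commute)
    ultimately show ?thesis unfolding v_def by metis
  qed
  moreover have "A x - A y = \<kappa> *\<^sub>R ((x - \<pi> x) - (y - \<pi> y)) + (gradf \<phi> x - gradf \<phi> y)"
    by (simp add: A_def algebra_simps)
  ultimately have A: "(A x - A y) \<bullet> (x - y) = \<kappa> * v\<^sup>2 + (gradf \<phi> x - gradf \<phi> y) \<bullet> (x - y)"
    by (metis inner_add_left inner_scaleR_left)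
  then have A2: "(A x - A y) \<bullet> (x - y) \<ge> \<kappa> * v\<^sup>2 + \<mu> * z\<^sup>2"
    using gradf_\<phi>_monotone[of x y] by (simp add: z_def)
  have "m \<le> \<kappa>" using m_pos by (simp add: \<kappa>_def)
  moreover have "m \<le> \<mu>" 
  proof -
    have "\<mu> = 2 * m + \<alpha> * L" by (simp add: m_def field_simps)
    then show ?thesis using m_pos mult_pos_pos[OF \<alpha>_pos L_pos] by linarith
  qed
  ultimately have "m * v\<^sup>2 \<le> \<kappa> * v\<^sup>2" "m * z\<^sup>2 \<le> \<mu> * z\<^sup>2"
    by (auto intro: mult_right_mono)
  then show "m * (norm (x - y))\<^sup>2 \<le> (A x - A y) \<bullet> (x - y)"
    using A2 unfolding n by (simp add: algebra_simps)
  have "\<pi> (gradf f x - gradf f y) \<bullet> (x - y) = (gradf f x - gradf f y) \<bullet> \<pi> (x - y)" by (rule \<pi>_sym)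
  also have "\<dots> \<le> norm (gradf f x - gradf f y) * z" unfolding z_def by (rule norm_cauchy_schwarz)
  also have "\<dots> \<le> L * norm (x - y) * z" using vz by (intro mult_right_mono f_lip)
  also have "\<dots> \<le> L * (z + v) * z"
  proof -
    have "norm (x - y) \<le> z + v"
      using norm_triangle_ineq[of "\<pi> (x - y)" "(x - y) - \<pi> (x - y)"] by (simp add: z_def v_def)
    then show ?thesis using L_pos vz by (intro mult_right_mono mult_left_mono) auto
  qed
  finally have "\<alpha> * (\<pi> (gradf f x - gradf f y) \<bullet> (x - y)) \<le> \<alpha> * (L * (z + v) * z)"
    using \<alpha>_pos by (intro mult_left_mono) auto
  moreover have "(B x - B y) \<bullet> (x - y) = (A x - A y) \<bullet> (x - y) - \<alpha> * (\<pi> (gradf f x - gradf f y) \<bullet> (x - y))"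
    by (simp add: B_def \<pi>_diff inner_diff_left algebra_simps)
  ultimately have "(B x - B y) \<bullet> (x - y) \<ge> \<kappa> * v\<^sup>2 + \<mu> * z\<^sup>2 - \<alpha> * L * (z + v) * z"
    using A2 by (simp add: algebra_simps)
  \<comment> \<open>Since \<mu> equals \<open>2 * m + \<alpha> * L\<close>, the mixed term
    \<open>\<alpha> * L * v * z\<close> is all that must be absorbed, and \<kappa> is exactly the
    weight that completes the square.\<close>
  also have "\<kappa> * v\<^sup>2 + \<mu> * z\<^sup>2 - \<alpha> * L * (z + v) * z
      = m * (z\<^sup>2 + v\<^sup>2) + (2 * m * z - \<alpha> * L * v)\<^sup>2 / (4 * m)"
  proof -
    have "(r + b\<^sup>2 / (4 * r)) * v\<^sup>2 + (2 * r + b) * z\<^sup>2 - b * (z + v) * z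
        = r * (z\<^sup>2 + v\<^sup>2) + (2 * r * z - b * v)\<^sup>2 / (4 * r)" if "r > 0" for r b :: real
      using that by (simp add: power2_eq_square field_simps)
    moreover have "2 * m + \<alpha> * L = \<mu>" by (simp add: m_def field_simps)
    ultimately show ?thesis using m_pos \<kappa>_def by metis
  qed
  finally show "m * (norm (x - y))\<^sup>2 \<le> (B x - B y) \<bullet> (x - y)"
    unfolding n using m_pos by (smt (verit) divide_nonneg_pos zero_le_power2)
qed

lemma A_has_derivative:
  "(A has_derivative (\<lambda>v. \<kappa> *\<^sub>R (v - \<pi> v) + frechet_derivative (gradf \<phi>) (at x) v)) (at x)"
  unfolding A_def
  by (intro has_derivative_add has_derivative_scaleR_right has_derivative_diff has_derivative_ident
      linear_imp_has_derivative \<pi>_linear C2_gradf_has_derivative \<phi>_C2)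

lemma B_has_derivative:
  "(B has_derivative (\<lambda>v. \<kappa> *\<^sub>R (v - \<pi> v) + frechet_derivative (gradf \<phi>) (at x) v - \<alpha> *\<^sub>R \<pi> (H x v))) (at x)"
  unfolding B_def
  by (intro has_derivative_diff A_has_derivative has_derivative_scaleR_right
      has_derivative_compose[OF C2_gradf_has_derivative[OF f_C2] linear_imp_has_derivative[OF \<pi>_linear]])

lemma A_strict_derivative:
  "has_strict_derivative A (\<lambda>v. \<kappa> *\<^sub>R (v - \<pi> v) + frechet_derivative (gradf \<phi>) (at x) v) x"
  by (rule has_strict_derivative_C1[OF A_has_derivative])
    (use \<phi>_C2 in \<open>auto simp: C2_def intro!: continuous_intros\<close>)

lemma B_strict_derivative:
  "has_strict_derivative B
    (\<lambda>v. \<kappa> *\<^sub>R (v - \<pi> v) + frechet_derivative (gradf \<phi>) (at x) v - \<alpha> *\<^sub>R \<pi> (H x v)) x"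
proof (rule has_strict_derivative_C1[OF B_has_derivative])
  have "continuous_on UNIV \<pi>"
    using \<pi>_linear linear_continuous_on linear_conv_bounded_linear by blast
  then show "continuous_on UNIV (\<lambda>x. \<kappa> *\<^sub>R (v - \<pi> v) + frechet_derivative (gradf \<phi>) (at x) v - \<alpha> *\<^sub>R \<pi> (H x v))" for v
    using \<phi>_C2 f_C2 by (auto simp: C2_def intro!: continuous_intros continuous_on_compose2[of UNIV \<pi>])
qed

lemma A_expanding: "m * norm (x - y) \<le> norm (A x - A y)"
  by (rule strongly_monotone_norm[OF A_monotone])

lemma B_expanding: "m * norm (x - y) \<le> norm (B x - B y)"
  by (rule strongly_monotone_norm[OF B_monotone])

section \<open>The block subproblem, its minimiser and the step map\<close>

definition "objective x u = u \<bullet> \<pi> (gradf f x) + (1 / \<alpha>) * bregman \<phi> u (\<pi> x)"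
definition "step x = x - \<pi> x + arg_min (objective x) (\<lambda>u. u \<in> range \<pi>)"

lemma objective_has_derivative:
  "(objective x has_derivative (\<lambda>h. h \<bullet> (\<pi> (gradf f x) + (1 / \<alpha>) *\<^sub>R (gradf \<phi> u - gradf \<phi> x)))) (at u)"
proof -
  have "(objective x has_derivative
      (\<lambda>h. h \<bullet> \<pi> (gradf f x) + (1 / \<alpha>) * (h \<bullet> gradf \<phi> u - 0 - (h - 0) \<bullet> gradf \<phi> (\<pi> x)))) (at u)"
    unfolding objective_def bregman_def
    by (intro has_derivative_add has_derivative_mult_right has_derivative_diff has_derivative_inner_left
        has_derivative_ident has_derivative_const C2_has_derivative[OF \<phi>_C2])
  then show ?thesis by (simp add: gradf_\<phi>_\<pi> inner_add_right inner_diff_right)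
qed

text \<open>Strong convexity bounds the Bregman term below by a quadratic, which beats the linear
  term outside the ball of radius \<open>2 * \<alpha> * norm w / \<mu>\<close> around
  \<open>\<pi> x\<close>; inside, compactness applies. Existence is essential because
  \<open>arg_min\<close> is a choice operator.\<close>

lemma objective_minimizer_exists: "\<exists>u. is_arg_min (objective x) (\<lambda>u. u \<in> range \<pi>) u"
proof -
  define w where "w = \<pi> (gradf f x)"
  define r where "r = 2 * \<alpha> * norm w / \<mu>"
  have "r \<ge> 0" using \<alpha>_pos \<mu>_pos by (simp add: r_def)
  define K where "K = range \<pi> \<inter> cball (\<pi> x) r"
  have "closed (range \<pi>)"
    by (intro closed_subspace linear_subspace_image \<pi>_linear subspace_UNIV)
  then have "compact K" unfolding K_def by (rule closed_Int_compact) simp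
  have xK: "\<pi> x \<in> K" using \<open>r \<ge> 0\<close> by (simp add: K_def)
  have "continuous_on K (objective x)"
    by (intro continuous_at_imp_continuous_on ballI has_derivative_continuous[OF objective_has_derivative])
  then obtain u0 where u0: "u0 \<in> K" "\<And>u. u \<in> K \<Longrightarrow> objective x u0 \<le> objective x u"
    using continuous_attains_inf[OF \<open>compact K\<close>] xK by blast
  have far: "objective x (\<pi> x) \<le> objective x u" if u: "u \<in> range \<pi>" "u \<notin> K" for u
  proof -
    define n where "n = norm (u - \<pi> x)"
    have n: "r < n" using u by (auto simp: K_def n_def dist_norm norm_minus_commute)
    have "bregman \<phi> u (\<pi> x) \<ge> \<mu> / 2 * n\<^sup>2"
      using \<phi>_sc u(1) unfolding strongly_convex_on_def bregman_def n_def
      by (smt (verit, best) inner_commute rangeI)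
    then have "(1 / \<alpha>) * bregman \<phi> u (\<pi> x) \<ge> (1 / \<alpha>) * (\<mu> / 2 * n\<^sup>2)"
      using \<alpha>_pos by (intro mult_left_mono) auto
    moreover have "\<bar>(u - \<pi> x) \<bullet> w\<bar> \<le> n * norm w"
      unfolding n_def by (rule Cauchy_Schwarz_ineq2)
    moreover have "n * norm w \<le> (1 / \<alpha>) * (\<mu> / 2 * n\<^sup>2)"
    proof -
      have "norm w = \<mu> / (2 * \<alpha>) * r" using \<alpha>_pos \<mu>_pos by (simp add: r_def)
      also have "\<dots> \<le> \<mu> / (2 * \<alpha>) * n" using n \<alpha>_pos \<mu>_pos by (intro mult_left_mono) auto
      finally have "n * norm w \<le> n * (\<mu> / (2 * \<alpha>) * n)" by (intro mult_left_mono) (simp_all add: n_def)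
      then show ?thesis by (simp add: power2_eq_square mult_ac)
    qed
    moreover have "objective x (\<pi> x) = \<pi> x \<bullet> w" by (simp add: objective_def bregman_def w_def)
    ultimately show ?thesis
      unfolding objective_def[of x u] w_def[symmetric] by (simp add: inner_diff_left)
  qed
  have "is_arg_min (objective x) (\<lambda>u. u \<in> range \<pi>) u0"
    unfolding is_arg_min_linorder
  proof (intro conjI allI impI)
    show "u0 \<in> range \<pi>" using u0(1) by (simp add: K_def)
    show "objective x u0 \<le> objective x u" if "u \<in> range \<pi>" for u
      using u0(2) far[OF that] xK by (cases "u \<in> K") (auto intro: order_trans)
  qed
  then show ?thesis by blast
qed

text \<open>The gradient \<open>D\<close> of the objective lies in the block, so the line through
  \<open>u\<close> in direction \<open>D\<close> is admissible. Minimality along it gives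
  \<open>D \<bullet> D = 0\<close>.\<close>

lemma objective_minimizer_gradient:
  assumes "is_arg_min (objective x) (\<lambda>u. u \<in> range \<pi>) u"
  shows "gradf \<phi> u = gradf \<phi> x - \<alpha> *\<^sub>R \<pi> (gradf f x)"
proof -
  define D where "D = \<pi> (gradf f x) + (1 / \<alpha>) *\<^sub>R (gradf \<phi> u - gradf \<phi> x)"
  have u: "u \<in> range \<pi>" and umin: "\<And>v. v \<in> range \<pi> \<Longrightarrow> objective x u \<le> objective x v"
    using assms by (auto simp: is_arg_min_linorder)
  have "\<pi> D = D"
    using \<pi>_linear by (simp add: D_def linear_add linear_cmul linear_diff \<pi>_idem gradf_\<phi>_range)
  moreover have "\<pi> u = u" using u \<pi>_idem by auto
  ultimately have in_range: "u + t *\<^sub>R D \<in> range \<pi>" for t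
    using \<pi>_linear by (intro range_eqI[of _ _ "u + t *\<^sub>R D"]) (simp add: linear_add linear_cmul)
  have der: "((\<lambda>t. objective x (u + t *\<^sub>R D)) has_derivative (\<lambda>t. (t *\<^sub>R D) \<bullet> D)) (at 0)"
  proof -
    have "((\<lambda>t. u + t *\<^sub>R D) has_derivative (\<lambda>t. t *\<^sub>R D)) (at 0)"
      by (auto intro!: derivative_eq_intros)
    moreover have "(objective x has_derivative (\<lambda>h. h \<bullet> D)) (at (u + 0 *\<^sub>R D))"
      using objective_has_derivative[of x u] by (simp add: D_def)
    ultimately show ?thesis by (rule has_derivative_compose)
  qed
  have "((\<lambda>t. objective x (u + t *\<^sub>R D)) has_real_derivative (D \<bullet> D)) (at 0)"
  proof -
    have "(\<lambda>t. (t *\<^sub>R D) \<bullet> D) = (*) (D \<bullet> D)" by (rule ext) simp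
    with der show ?thesis by (simp only: has_field_derivative_def)
  qed
  then have "D \<bullet> D = 0"
    by (rule DERIV_local_min[of _ _ _ 1]) (use umin[OF in_range] in auto)
  then have "\<alpha> *\<^sub>R D = 0" by simp
  then have "\<alpha> *\<^sub>R \<pi> (gradf f x) + (gradf \<phi> u - gradf \<phi> x) = 0"
    using \<alpha>_pos by (simp add: D_def scaleR_add_right)
  then show ?thesis by (simp add: algebra_simps eq_neg_iff_add_eq_0)
qed

text \<open>The step keeps the component outside the block, so the \<kappa> terms agree; the rest is
  the optimality condition of the minimiser.\<close>

lemma A_step: "A (step x) = B x"
proof -
  define u where "u = arg_min (objective x) (\<lambda>u. u \<in> range \<pi>)"
  have u: "is_arg_min (objective x) (\<lambda>u. u \<in> range \<pi>) u"
    unfolding u_def arg_min_def by (rule someI_ex[OF objective_minimizer_exists])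
  then have "\<pi> u = u" using \<pi>_idem by (auto simp: is_arg_min_def)
  then have "\<pi> (step x) = u"
    using \<pi>_linear by (simp add: step_def u_def[symmetric] linear_add linear_diff \<pi>_idem)
  moreover from this have "gradf \<phi> (step x) = gradf \<phi> u" by (metis gradf_\<phi>_\<pi>)
  moreover have "step x = x - \<pi> x + u" by (simp add: step_def u_def)
  ultimately show ?thesis
    using objective_minimizer_gradient[OF u] by (simp add: A_def B_def)
qed

lemma continuous_step: "continuous_on UNIV step"
proof -
  have "isCont step x" for x
  proof -
    have "isCont B x" by (rule has_derivative_continuous[OF B_has_derivative])
    then have "((\<lambda>y. norm (B y - B x) / m) \<longlongrightarrow> norm (B x - B x) / m) (at x)"
      by (intro tendsto_intros) (use m_pos in \<open>auto simp: isCont_def\<close>)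
    then have lim: "((\<lambda>y. norm (B y - B x) / m) \<longlongrightarrow> 0) (at x)" by simp
    have "norm (step y - step x) \<le> norm (B y - B x) / m" for y
      using A_expanding[of "step y" "step x"] m_pos by (simp add: A_step field_simps)
    then have "((\<lambda>y. step y - step x) \<longlongrightarrow> 0) (at x)"
      by (intro Lim_null_comparison[OF _ lim] always_eventually allI)
    then show ?thesis by (simp add: isCont_def LIM_zero_iff)
  qed
  then show ?thesis by (simp add: continuous_on_eq_continuous_at)
qed

text \<open>If \<open>step x\<close> lies in \<open>N\<close>, then \<open>B x\<close> lies in
  \<open>A\<close> N\<open>. Differentiability keeps\<close>A \<open>N\<close> null, and expansion
  of \<open>B\<close> pulls it back to a null set.\<close>

lemma negligible_vimage_step:
  assumes "negligible N"
  shows "negligible (step -` N)"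
proof -
  have "A differentiable_on N"
    using A_has_derivative by (meson differentiable_at_imp_differentiable_on differentiable_def)
  then have "negligible (A ` N)"
    using negligible_differentiable_image_negligible[OF order_refl assms] by blast
  then have "negligible (B -` (A ` N))"
    by (rule negligible_vimage_expanding[OF m_pos B_expanding])
  moreover have "step -` N \<subseteq> B -` (A ` N)" by (auto simp: A_step[symmetric])
  ultimately show ?thesis by (rule negligible_subset)
qed

lemma step_critical:
  assumes "gradf f p = 0"
  shows "step p = p"
proof -
  have "A (step p) = A p" using assms by (simp add: A_step B_def linear_0[OF \<pi>_linear])
  then have "m * norm (step p - p) \<le> 0" using A_expanding[of "step p" p] by simp
  then show ?thesis using m_pos by (simp add: mult_le_0_iff)
qed

section \<open>Linearisation of a block step at a critical point\<close>

lemma H_symmetric: "H p u \<bullet> v = u \<bullet> H p v"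
  by (rule strict_derivative_gradient_symmetric[OF C2_has_derivative[OF f_C2] C2_gradf_strict_derivative[OF f_C2]])

lemma linear_H: "linear (H p)"
  by (rule has_derivative_linear[OF C2_gradf_has_derivative[OF f_C2]])

text \<open>The Lipschitz bound makes \<open>L *\<^sub>R x - gradf f x\<close> monotone, so its
  derivative is positive semidefinite.\<close>

lemma H_le: "v \<bullet> H p v \<le> L * (v \<bullet> v)"
proof -
  define F where "F = (\<lambda>x. L *\<^sub>R x - gradf f x)"
  have "has_strict_derivative F (\<lambda>v. L *\<^sub>R v - H p v) p"
  proof (rule has_strict_derivative_C1)
    show "(F has_derivative (\<lambda>v. L *\<^sub>R v - H x v)) (at x)" for x
      unfolding F_def
      by (intro has_derivative_diff has_derivative_scaleR_right has_derivative_ident C2_gradf_has_derivative f_C2)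
    show "continuous_on UNIV (\<lambda>x. L *\<^sub>R v - H x v)" for v
      using f_C2 by (auto simp: C2_def intro!: continuous_intros)
  qed
  moreover have "0 * (norm (x - y))\<^sup>2 \<le> (F x - F y) \<bullet> (x - y)" for x y
  proof -
    have "(gradf f x - gradf f y) \<bullet> (x - y) \<le> norm (gradf f x - gradf f y) * norm (x - y)"
      by (rule norm_cauchy_schwarz)
    also have "\<dots> \<le> L * norm (x - y) * norm (x - y)" by (intro mult_right_mono f_lip) simp
    finally have "(gradf f x - gradf f y) \<bullet> (x - y) \<le> (L *\<^sub>R (x - y)) \<bullet> (x - y)"
      by (simp add: power2_norm_eq_inner[symmetric] power2_eq_square mult.assoc)
    then show ?thesis by (simp add: F_def algebra_simps)
  qed
  ultimately have "0 * (norm v)\<^sup>2 \<le> (L *\<^sub>R v - H p v) \<bullet> v"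
    using strict_derivative_monotone[of F _ p 0 "\<lambda>x. x"] linear_ident by blast
  then have "0 \<le> L * (v \<bullet> v) - H p v \<bullet> v" by (simp add: inner_diff_left)
  then show ?thesis by (simp add: inner_commute)
qed

text \<open>The increment \<open>d = T v - v\<close> lies in the block and solves
  \<open>D d = - \<alpha> *\<^sub>R \<pi> (H p v)\<close>. Pairing with \<open>d\<close> gives
  \<open>L * (norm d)\<^sup>2 \<le> - (d \<bullet> H p v)\<close>, and with \<open>H \<le> L\<close>
  as forms the value \<open>v \<bullet> H p v\<close> drops by at least
  \<open>L * (norm d)\<^sup>2\<close>. Equality forces \<open>d = 0\<close>, hence a vanishing block
  of \<open>H p v\<close>.\<close>

lemma step_strict_derivative:
  assumes p: "gradf f p = 0"
  obtains T where "has_strict_derivative step T p"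
    "\<And>v. H p v = 0 \<Longrightarrow> T v = v" "\<And>v. T v \<bullet> H p (T v) \<le> v \<bullet> H p v"
    "\<And>v. T v \<bullet> H p (T v) = v \<bullet> H p v \<Longrightarrow> T v = v \<and> \<pi> (H p v) = 0"
proof -
  define D where "D = frechet_derivative (gradf \<phi>) (at p)"
  define A' where "A' = (\<lambda>v. \<kappa> *\<^sub>R (v - \<pi> v) + D v)"
  define B' where "B' = (\<lambda>v. A' v - \<alpha> *\<^sub>R \<pi> (H p v))"
  have A: "has_strict_derivative A A' p" and B: "has_strict_derivative B B' p"
    using A_strict_derivative B_strict_derivative by (simp_all add: A'_def B'_def D_def)
  have linA: "linear A'" and linB: "linear B'"
    using A B by (simp_all add: has_strict_derivative_def bounded_linear.linear)
  have D: "has_strict_derivative (gradf \<phi>) D p"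
    unfolding D_def by (rule C2_gradf_strict_derivative[OF \<phi>_C2])
  have D_mono: "\<mu> * (norm (\<pi> v))\<^sup>2 \<le> D v \<bullet> v" for v
    by (rule strict_derivative_monotone[OF D gradf_\<phi>_monotone \<pi>_linear])
  have D_range: "\<pi> (D v) = D v" for v
  proof -
    have "((\<lambda>x. \<pi> (gradf \<phi> x)) has_derivative (\<lambda>v. \<pi> (D v))) (at p)"
      unfolding D_def
      by (rule has_derivative_compose[OF C2_gradf_has_derivative[OF \<phi>_C2] linear_imp_has_derivative[OF \<pi>_linear]])
    then have "(gradf \<phi> has_derivative (\<lambda>v. \<pi> (D v))) (at p)" by (simp add: gradf_\<phi>_range)
    then have "(\<lambda>v. \<pi> (D v)) = D"
      unfolding D_def using C2_gradf_has_derivative[OF \<phi>_C2] by (rule has_derivative_unique)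
    then show ?thesis by metis
  qed
  have A'_exp: "m * norm v \<le> norm (A' v)" for v
  proof -
    have "m * (norm v)\<^sup>2 \<le> A' v \<bullet> v"
      by (rule strict_derivative_monotone[OF A _ linear_ident]) (rule A_monotone)
    then show ?thesis
      using strongly_monotone_norm[of m v 0 A'] by (simp add: linear_0[OF linA])
  qed
  have "inj A'"
    unfolding linear_injective_0[OF linA]
    using A'_exp m_pos by (metis mult_le_0_iff norm_le_zero_iff norm_zero not_le)
  then obtain E where E: "linear E" "\<And>v. A' (E v) = v" "\<And>v. E (A' v) = v"
    using linear_injective_isomorphism[OF linA] by blast
  define T where "T = (\<lambda>v. E (B' v))"
  have "linear T" unfolding T_def using linear_compose[OF linB E(1)] by (simp add: comp_def)
  then have bT: "bounded_linear T" by (simp add: linear_conv_bounded_linear)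
  have AT: "A' (T v) = B' v" for v by (simp add: T_def E)
  \<comment> \<open>The right-hand side of the equation for \<open>d\<close> lies in the block; as
    \<kappa> is positive, the component of \<open>d\<close> outside the block must vanish.\<close>
  have diff: "\<pi> (T v - v) = T v - v" "D (T v - v) = - \<alpha> *\<^sub>R \<pi> (H p v)" for v
  proof -
    define d where "d = T v - v"
    have Ad: "A' d = - \<alpha> *\<^sub>R \<pi> (H p v)"
      by (simp add: d_def linear_diff[OF linA] AT B'_def)
    then have "\<pi> (A' d) = A' d" by (simp add: linear_cmul[OF \<pi>_linear] linear_neg[OF \<pi>_linear] \<pi>_idem)
    moreover have "\<pi> (A' d) = D d"
      using \<pi>_linear by (simp add: A'_def linear_add linear_cmul linear_diff \<pi>_idem D_range)
    ultimately have "\<kappa> *\<^sub>R (d - \<pi> d) = 0" by (simp add: A'_def)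
    moreover have "\<kappa> > 0" using m_pos by (simp add: \<kappa>_def add_pos_nonneg)
    ultimately show "\<pi> (T v - v) = T v - v" by (simp add: d_def)
    show "D (T v - v) = - \<alpha> *\<^sub>R \<pi> (H p v)"
      using \<open>\<pi> (A' d) = D d\<close> \<open>\<pi> (A' d) = A' d\<close> Ad by (simp add: d_def)
  qed
  have descent: "T v \<bullet> H p (T v) \<le> v \<bullet> H p v - L * (norm (T v - v))\<^sup>2" for v
  proof -
    define d where "d = T v - v"
    have d: "\<pi> d = d" "D d = - \<alpha> *\<^sub>R \<pi> (H p v)" using diff[of v] by (simp_all add: d_def)
    have "\<mu> * (norm d)\<^sup>2 \<le> - \<alpha> * (\<pi> (H p v) \<bullet> d)" using D_mono[of d] d by simp
    also have "\<pi> (H p v) \<bullet> d = d \<bullet> H p v" using d(1) by (metis \<pi>_sym inner_commute)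
    finally have 1: "\<mu> * (norm d)\<^sup>2 \<le> - \<alpha> * (d \<bullet> H p v)" .
    have "\<alpha> * (L * (norm d)\<^sup>2) \<le> \<mu> * (norm d)\<^sup>2"
      using \<alpha>_less by (simp add: mult.assoc[symmetric] mult_right_mono)
    with 1 have "\<alpha> * (L * (norm d)\<^sup>2) \<le> \<alpha> * (- (d \<bullet> H p v))" by simp
    then have 2: "L * (norm d)\<^sup>2 \<le> - (d \<bullet> H p v)" using \<alpha>_pos by (rule mult_left_le_imp_le)
    have "T v = v + d" by (simp add: d_def)
    then have "T v \<bullet> H p (T v) = v \<bullet> H p v + 2 * (d \<bullet> H p v) + d \<bullet> H p d"
      using H_symmetric[of p d v]
      by (simp add: linear_add[OF linear_H] inner_add_left inner_add_right inner_commute)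
    also have "\<dots> \<le> v \<bullet> H p v - L * (norm d)\<^sup>2"
      using 2 H_le[of d p] by (simp add: power2_norm_eq_inner)
    finally show ?thesis by (simp add: d_def)
  qed
  show thesis
  proof (rule that[of T])
    show "has_strict_derivative step T p"
      by (rule has_strict_derivative_implicit[OF A B m_pos A_expanding A'_exp A_step step_critical[OF p] bT AT])
    show "T v = v" if "H p v = 0" for v
    proof -
      have "B' v = A' v" using that by (simp add: B'_def linear_0[OF \<pi>_linear])
      then show ?thesis by (simp add: T_def E)
    qed
    show "T v \<bullet> H p (T v) \<le> v \<bullet> H p v" for v
      using descent[of v] L_pos by (smt (verit) mult_nonneg_nonneg zero_le_power2)
    show "T v = v \<and> \<pi> (H p v) = 0" if "T v \<bullet> H p (T v) = v \<bullet> H p v" for v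
    proof -
      have "L * (norm (T v - v))\<^sup>2 \<le> 0" using descent[of v] that by simp
      then have "T v - v = 0" using L_pos by (simp add: mult_le_0_iff)
      moreover have "D 0 = 0" using D by (simp add: has_strict_derivative_def linear_0 bounded_linear.linear)
      ultimately show ?thesis using diff(2)[of v] \<alpha>_pos by simp
    qed
  qed
qed

end

section \<open>Composition of block steps\<close>

text \<open>The predicate \<open>C\<close> records which components of \<open>H v\<close> must vanish when the form of \<open>H\<close> is not
  strictly decreased; this is what makes the notion stable under composition of block steps.\<close>

definition descending_map ::
  "('a::euclidean_space \<Rightarrow> 'a) \<Rightarrow> 'a \<Rightarrow> ('a \<Rightarrow> bool) \<Rightarrow> ('a \<Rightarrow> 'a) \<Rightarrow> bool" where
  "descending_map H p C g \<longleftrightarrow> continuous_on UNIV g \<and>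
     (\<forall>N. negligible N \<longrightarrow> negligible (g -` N)) \<and> g p = p \<and>
     (\<exists>T. has_strict_derivative g T p \<and> (\<forall>v. H v = 0 \<longrightarrow> T v = v) \<and>
       (\<forall>v. T v \<bullet> H (T v) \<le> v \<bullet> H v) \<and> (\<forall>v. T v \<bullet> H (T v) = v \<bullet> H v \<longrightarrow> T v = v \<and> C v))"

lemma descending_map_id: "descending_map H p (\<lambda>_. True) id"
proof -
  have "has_strict_derivative id id p"
    unfolding has_strict_derivative_def by (auto intro!: exI[of _ 1] simp: id_def bounded_linear_ident)
  then show ?thesis
    unfolding descending_map_def by (auto intro!: exI[of _ id] simp: id_def)
qed

text \<open>Equality for the composite forces equality in both factors. The first then gives
  \<open>T v = v\<close>, so the second is tested at the same \<open>v\<close> and both conditions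
  hold there.\<close>

lemma descending_map_comp:
  assumes g: "descending_map H p C g" and g': "descending_map H p C' g'"
  shows "descending_map H p (\<lambda>v. C v \<and> C' v) (g' \<circ> g)"
proof -
  obtain T where T: "has_strict_derivative g T p" "\<And>v. H v = 0 \<Longrightarrow> T v = v"
    "\<And>v. T v \<bullet> H (T v) \<le> v \<bullet> H v" "\<And>v. T v \<bullet> H (T v) = v \<bullet> H v \<Longrightarrow> T v = v \<and> C v"
    using g unfolding descending_map_def by blast
  obtain T' where T': "has_strict_derivative g' T' p" "\<And>v. H v = 0 \<Longrightarrow> T' v = v"
    "\<And>v. T' v \<bullet> H (T' v) \<le> v \<bullet> H v" "\<And>v. T' v \<bullet> H (T' v) = v \<bullet> H v \<Longrightarrow> T' v = v \<and> C' v"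
    using g' unfolding descending_map_def by blast
  have cont: "continuous_on UNIV g" "continuous_on UNIV g'" and p: "g p = p" "g' p = p"
    using g g' by (auto simp: descending_map_def)
  have "continuous_on UNIV (g' \<circ> g)"
    using continuous_on_compose2[OF cont(2,1)] by (simp add: comp_def)
  moreover have "negligible ((g' \<circ> g) -` N)" if "negligible N" for N
    using g g' that unfolding descending_map_def vimage_comp[symmetric] by blast
  moreover have "has_strict_derivative (g' \<circ> g) (T' \<circ> T) p"
    using has_strict_derivative_compose[OF T(1)] T'(1) p by simp
  moreover have "T' (T v) \<bullet> H (T' (T v)) \<le> v \<bullet> H v" for v
    using T(3)[of v] T'(3)[of "T v"] by linarith
  moreover have "T' (T v) = v \<and> C v \<and> C' v" if eq: "T' (T v) \<bullet> H (T' (T v)) = v \<bullet> H v" for v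
  proof -
    have "T v \<bullet> H (T v) = v \<bullet> H v" using T(3)[of v] T'(3)[of "T v"] eq by linarith
    then have v: "T v = v" "C v" using T(4) by auto
    then show ?thesis using T'(4)[of v] eq by simp
  qed
  ultimately show ?thesis
    unfolding descending_map_def using T(2) T'(2) p by (auto intro!: exI[of _ "T' \<circ> T"])
qed

lemma descending_map_fold:
  assumes "\<And>s. s \<in> set ss \<Longrightarrow> descending_map H p (C s) (G s)"
  shows "descending_map H p (\<lambda>v. \<forall>s\<in>set ss. C s v) (fold G ss)"
  using assms
proof (induction ss)
  case (Cons s ss)
  then have "descending_map H p (\<lambda>v. C s v \<and> (\<forall>s\<in>set ss. C s v)) (fold G ss \<circ> G s)"
    by (intro descending_map_comp) auto
  then show ?case by (simp add: comp_def)
qed (simp add: descending_map_id)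

text \<open>A convergent orbit eventually stays in the small ball, so its starting point lies in one
  of countably many iterated preimages of the trapped set.\<close>

lemma negligible_attracted_to_saddle:
  fixes H :: "'a::euclidean_space \<Rightarrow> 'a"
  assumes g: "descending_map H p C g" and C: "\<And>v. C v \<Longrightarrow> H v = 0"
    and H: "linear H" "\<And>x y. H x \<bullet> y = x \<bullet> H y" and w: "w \<bullet> H w < 0"
  shows "negligible {x. (\<lambda>k. (g ^^ k) x) \<longlonglongrightarrow> p}"
proof -
  obtain M where M: "has_strict_derivative g M p" "\<And>v. H v = 0 \<Longrightarrow> M v = v"
    "\<And>v. M v \<bullet> H (M v) \<le> v \<bullet> H v" "\<And>v. M v \<bullet> H (M v) = v \<bullet> H v \<Longrightarrow> H v = 0"
    using g C unfolding descending_map_def by blast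
  have cont: "continuous_on UNIV g" using g by (simp add: descending_map_def)
  have linM: "linear M" using M(1) by (simp add: has_strict_derivative_def bounded_linear.linear)
  obtain \<beta> \<rho> c u where \<beta>: "bounded_bilinear \<beta>" "\<rho> > (1::real)" "c > 0"
    "\<And>x. \<beta> (M x) (M x) \<le> \<rho> * \<beta> x x - c * (norm x)\<^sup>2" "\<beta> u u < (0::real)"
    using symmetric_form_expanding[OF H linM M(2-4) w] by metis
  obtain r where r: "r > 0" "negligible {x. \<forall>k. (g ^^ k) x \<in> cball p r}"
    using negligible_trapped_points[OF cont M(1) \<beta>] by metis
  define S where "S = {x. \<forall>k. (g ^^ k) x \<in> cball p r}"
  have "negligible ((g ^^ n) -` S)" for n
  proof (induction n)
    case (Suc n)
    then have "negligible (g -` ((g ^^ n) -` S))" using g by (simp add: descending_map_def)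
    moreover have "(g ^^ Suc n) -` S = g -` ((g ^^ n) -` S)"
      by (simp only: funpow_Suc_right vimage_comp)
    ultimately show ?case by (simp only:)
  qed (use r in \<open>simp add: S_def\<close>)
  then have "negligible (\<Union>n. (g ^^ n) -` S)" by (intro negligible_Union_nat)
  moreover have "{x. (\<lambda>k. (g ^^ k) x) \<longlonglongrightarrow> p} \<subseteq> (\<Union>n. (g ^^ n) -` S)"
  proof
    fix x assume "x \<in> {x. (\<lambda>k. (g ^^ k) x) \<longlonglongrightarrow> p}"
    then obtain n where n: "\<And>k. k \<ge> n \<Longrightarrow> dist ((g ^^ k) x) p < r"
      using r(1) unfolding lim_sequentially by blast
    have "(g ^^ k) ((g ^^ n) x) \<in> cball p r" for k
      using n[of "k + n"] by (simp add: funpow_add dist_commute)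
    then show "x \<in> (\<Union>n. (g ^^ n) -` S)" by (auto simp: S_def)
  qed
  ultimately show ?thesis by (rule negligible_subset)
qed

text \<open>\<open>negligible\<close> refers to the completed Lebesgue measure, while \<nu> lives on
  the Borel sets. Radii of the form \<open>inverse (real (Suc n))\<close> make all quantifiers
  countable.\<close>

lemma borel_convergence_set:
  fixes g :: "'a::euclidean_space \<Rightarrow> 'a"
  assumes "continuous_on UNIV g"
  shows "{x. (\<lambda>k. (g ^^ k) x) \<longlonglongrightarrow> p} \<in> sets borel"
proof -
  have [measurable]: "g ^^ k \<in> borel_measurable borel" for k
  proof (induction k)
    case (Suc k)
    then show ?case
      using measurable_comp[OF Suc borel_measurable_continuous_onI[OF assms]] by (simp add: comp_def)
  qed (simp add: id_def)
  have "((\<lambda>k. (g ^^ k) x) \<longlonglongrightarrow> p) \<longleftrightarrow> (\<forall>n. \<exists>N. \<forall>k\<ge>N. dist ((g ^^ k) x) p < inverse (real (Suc n)))" for x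
    unfolding lim_sequentially
    by (meson inverse_positive_iff_positive of_nat_0_less_iff order_less_trans reals_Archimedean zero_less_Suc)
  then have "{x. (\<lambda>k. (g ^^ k) x) \<longlonglongrightarrow> p}
      = {x \<in> space borel. \<forall>n. \<exists>N. \<forall>k\<ge>N. dist ((g ^^ k) x) p < inverse (real (Suc n))}" by simp
  also have "\<dots> \<in> sets borel" by measurable
  finally show ?thesis .
qed

section \<open>From coordinate blocks to projections, and the theorem\<close>

lemma range_proj: "range (proj blk s) = block_space blk s"
proof (intro set_eqI iffI)
  fix u assume "u \<in> block_space blk s"
  then have "u = proj blk s u" by (auto simp: block_space_def proj_def vec_eq_iff)
  then show "u \<in> range (proj blk s)" by blast
qed (auto simp: block_space_def proj_def)

lemma mirror_block_proj:
  assumes "C2 f" "\<forall>x y. norm (gradf f x - gradf f y) \<le> L * norm (x - y)" "L > 0" "\<alpha> > 0" "\<alpha> * L < m"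
    and "C2 \<psi>" "\<forall>x y. proj blk s x = proj blk s y \<longrightarrow> \<psi> x = \<psi> y"
    and "strongly_convex_on (block_space blk s) \<psi> m"
  shows "mirror_block f \<psi> (proj blk s) L m \<alpha>"
proof (rule mirror_block.intro)
  show "linear (proj blk s)" by (rule linearI) (auto simp: proj_def vec_eq_iff)
  show idem: "proj blk s (proj blk s x) = proj blk s x" for x by (simp add: proj_def vec_eq_iff)
  show "proj blk s x \<bullet> y = x \<bullet> proj blk s y" for x y
    by (auto simp: proj_def inner_vec_def intro!: sum.cong)
  show "\<psi> (proj blk s x) = \<psi> x" for x using assms(7) idem by blast
qed (use assms in \<open>auto simp: range_proj\<close>)

text \<open>Both sides choose the same \<open>arg_min\<close>. Because a minimiser exists, the
  chosen vector is supported on the block, so overwriting coordinates agrees with adding it to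
  \<open>x - \<pi> x\<close>, \<pi> being \<open>proj blk s\<close>.\<close>

lemma bmd_block_step_eq_step:
  assumes "mirror_block f (\<phi> s) (proj blk s) L m \<alpha>"
  shows "bmd_block_step f \<phi> \<alpha> blk s = mirror_block.step f (\<phi> s) (proj blk s) \<alpha>"
proof
  interpret mirror_block f "\<phi> s" "proj blk s" L m \<alpha> by fact
  fix x
  define u where "u = arg_min (objective x) (\<lambda>u. u \<in> range (proj blk s))"
  have "is_arg_min (objective x) (\<lambda>u. u \<in> range (proj blk s)) u"
    unfolding u_def arg_min_def by (rule someI_ex[OF objective_minimizer_exists])
  then have u: "u \<in> block_space blk s" by (simp add: is_arg_min_def range_proj)
  have "bmd_block_step f \<phi> \<alpha> blk s x = (\<chi> i. if blk i = s then u $ i else x $ i)"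
    unfolding bmd_block_step_def Let_def u_def objective_def[abs_def] range_proj ..
  also have "\<dots> = step x"
    using u unfolding step_def u_def[symmetric] by (auto simp: vec_eq_iff proj_def block_space_def)
  finally show "bmd_block_step f \<phi> \<alpha> blk s x = step x" .
qed

theorem theorem4:
  fixes f :: "real^'n \<Rightarrow> real" and L \<alpha> :: real and p :: nat
    and blk :: "'n \<Rightarrow> nat" and \<phi> :: "nat \<Rightarrow> real^'n \<Rightarrow> real" and \<mu> :: "nat \<Rightarrow> real"
    and xs :: "real^'n" and \<nu> :: "(real^'n) measure"
  assumes f_C2: "C2 f"
    and L_pos: "L > 0"
    and f_lip: "\<forall>x y. norm (gradf f x - gradf f y) \<le> L * norm (x - y)"
    and blk_range: "\<forall>i. blk i \<in> {1..p}"
    and blk_nonempty: "\<forall>t\<in>{1..p}. \<exists>i. blk i = t"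
    and \<phi>_block: "\<forall>t\<in>{1..p}. \<forall>x y. proj blk t x = proj blk t y \<longrightarrow> \<phi> t x = \<phi> t y"
    and \<phi>_C2: "\<forall>t\<in>{1..p}. C2 (\<phi> t)"
    and \<mu>_pos: "\<forall>t\<in>{1..p}. \<mu> t > 0"
    and \<phi>_sc: "\<forall>t\<in>{1..p}. strongly_convex_on (block_space blk t) (\<phi> t) (\<mu> t)"
    and saddle: "strict_saddle f xs"
    and \<alpha>_pos: "0 < \<alpha>"
    and \<alpha>_bound: "\<alpha> < Min (\<mu> ` {1..p}) / L"
    and \<nu>_prob: "prob_space \<nu>"
    and \<nu>_sets: "sets \<nu> = sets borel"
    and \<nu>_ac: "absolutely_continuous lborel \<nu>"
  shows "{x0. (\<lambda>k. (bmd_map f \<phi> \<alpha> blk p ^^ k) x0) \<longlonglongrightarrow> xs} \<in> null_sets \<nu>"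
proof -
  define H where "H = frechet_derivative (gradf f) (at xs)"
  have crit: "gradf f xs = 0" using saddle by (simp add: strict_saddle_def)
  have linH: "linear H"
    unfolding H_def by (rule has_derivative_linear[OF C2_gradf_has_derivative[OF f_C2]])
  have symH: "H u \<bullet> v = u \<bullet> H v" for u v
    unfolding H_def
    by (rule strict_derivative_gradient_symmetric[OF C2_has_derivative[OF f_C2] C2_gradf_strict_derivative[OF f_C2]])
  have hess: "hess f xs *v v = H v" for v
    unfolding hess_def H_def[symmetric] by (rule matrix_works) (use linH in \<open>simp add: linear_matrix_vector_mul_eq\<close>)
  obtain w where w: "w \<bullet> H w < 0"
    using lambda_min_negative_direction[of "hess f xs"] symH saddle
    unfolding strict_saddle_def hess by metis
  have step: "descending_map H xs (\<lambda>v. proj blk s (H v) = 0) (bmd_block_step f \<phi> \<alpha> blk s)"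
    if s: "s \<in> {1..p}" for s
  proof -
    have "Min (\<mu> ` {1..p}) \<le> \<mu> s" using s by simp
    then have "\<alpha> * L < \<mu> s" using \<alpha>_bound L_pos by (simp add: pos_less_divide_eq)
    then have mb: "mirror_block f (\<phi> s) (proj blk s) L (\<mu> s) \<alpha>"
      by (rule mirror_block_proj[OF f_C2 f_lip L_pos \<alpha>_pos _
            bspec[OF \<phi>_C2 s] bspec[OF \<phi>_block s] bspec[OF \<phi>_sc s]])
    interpret mirror_block f "\<phi> s" "proj blk s" L "\<mu> s" \<alpha> by (rule mb)
    obtain T where "has_strict_derivative step T xs"
      "\<And>v. H v = 0 \<Longrightarrow> T v = v" "\<And>v. T v \<bullet> H (T v) \<le> v \<bullet> H v"
      "\<And>v. T v \<bullet> H (T v) = v \<bullet> H v \<Longrightarrow> T v = v \<and> proj blk s (H v) = 0"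
      using step_strict_derivative[OF crit] unfolding H_def by blast
    then show ?thesis
      unfolding bmd_block_step_eq_step[where \<phi> = \<phi>, OF mb] descending_map_def
      using continuous_step negligible_vimage_step step_critical[OF crit] by blast
  qed
  have g: "descending_map H xs (\<lambda>v. \<forall>s\<in>set [1..<Suc p]. proj blk s (H v) = 0) (bmd_map f \<phi> \<alpha> blk p)"
    unfolding bmd_map_def by (rule descending_map_fold, rule step) auto
  \<comment> \<open>Every coordinate belongs to a block between 1 and \<open>p\<close>, so the
    conditions collected over one sweep annihilate all of \<open>H v\<close>.\<close>
  have "H v = 0" if "\<forall>s\<in>set [1..<Suc p]. proj blk s (H v) = 0" for v
  proof -
    have "H v $ i = 0" for i
    proof -
      have "blk i \<in> set [1..<Suc p]" using blk_range[rule_format, of i] by auto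
      then have "proj blk (blk i) (H v) $ i = 0" using that by (metis zero_index)
      then show ?thesis by (simp add: proj_def)
    qed
    then show ?thesis by (simp add: vec_eq_iff)
  qed
  from negligible_attracted_to_saddle[OF g this linH symH w]
  have "negligible {x0. (\<lambda>k. (bmd_map f \<phi> \<alpha> blk p ^^ k) x0) \<longlonglongrightarrow> xs}" .
  moreover have "{x0. (\<lambda>k. (bmd_map f \<phi> \<alpha> blk p ^^ k) x0) \<longlonglongrightarrow> xs} \<in> sets borel"
    using g by (intro borel_convergence_set) (simp add: descending_map_def)
  ultimately have "{x0. (\<lambda>k. (bmd_map f \<phi> \<alpha> blk p ^^ k) x0) \<longlonglongrightarrow> xs} \<in> null_sets lborel"
    by (simp add: negligible_iff_null_sets null_sets_def)
  then show ?thesis using \<nu>_ac unfolding absolutely_continuous_def by blast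
qed

end
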